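(* Let $m,n\in\mathbb N$ and let $\ell$ be an integer with $0\le\ell\le m+n$. Then the $\mathcal H$-module $(L_m\otimes L_n)(m+n-2\ell)$ is isomorphic to the irreducible $\mathcal H$-module $V_d(a,b)$, where $$a=\min\{n,\ell\}-\min\{m,\ell\}+\frac{m-n}{2},\qquad b=-\frac{m+n}{2}-1,\qquad d=\min\{m,\ell\}+\min\{n,\ell\}-\ell.$$
   Context: All algebras are unital associative over $\mathbb C$; $[x,y]=xy-yx$. $U(\mathfrak{sl}_2)$ is generated by $E,F,H$ with $[H,E]=2E$, $[H,F]=-2F$, $[E,F]=H$; $\Lambda=EF+FE+\frac{H^2}{2}$; $\Delta$ is the algebra homomorphism $U(\mathfrak{sl}_2)\to U(\mathfrak{sl}_2)\otimes U(\mathfrak{sl}_2)$ with $\Delta(X)=X\otimes1+1\otimes X$ for $X\in\{E,F,H\}$. For $n\in\mathbb N$, $L_n$ is the $U(\mathfrak{sl}_2)$-module with basis $v_0,\dots,v_n$, $Ev_i=iv_{i-1}$, $Ev_0=0$, $Fv_i=(n-i)v_{i+1}$, $Fv_n=0$, $Hv_i=(n-2i)v_i$; $L_m\otimes L_n$ is a $U(\mathfrak{sl}_2)\otimes U(\mathfrak{sl}_2)$-module componentwise. The universal Hahn algebra $\mathcal H$ is generated by $A,B,C$ with $[A,B]=C$ and each of $\alpha=[C,A]+2A^2+B$, $\beta=[B,C]+4BA+2C$ central. Let $\natural:\mathcal H\to U(\mathfrak{sl}_2)\otimes U(\mathfrak{sl}_2)$ be the algebra homomorphism with $A\mapsto\frac{H\otimes1-1\otimes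 H}{4}$, $B\mapsto\frac{\Delta(\Lambda)}2$, $C\mapsto E\otimes F-F\otimes E$; $U(\mathfrak{sl}_2)\otimes U(\mathfrak{sl}_2)$-modules are $\mathcal H$-modules via $\natural$. For such a module $V$ and $\theta\in\mathbb C$, $V(\theta)=\{v\in V:\Delta(H)v=\theta v\}$, an $\mathcal H$-submodule. For $a,b\in\mathbb C$, $d\in\mathbb N$, $V_d(a,b)$ denotes the $(d+1)$-dimensional $\mathcal H$-module with a basis $v_0,\dots,v_d$ such that $(A-\theta_i)v_i=\varphi_iv_{i-1}$ ($1\le i\le d$), $(A-\theta_0)v_0=0$, $(B-\theta_i^* )v_i=v_{i+1}$ ($0\le i\le d-1$), $(B-\theta^*_d)v_d=0$, where $\theta_i=\frac{a+d}{2}-i$, $\theta_i^*=(b+i)(b+i+1)$, $\varphi_i=i(i-d-1)(a-b-i)$ (such a module exists; since $\mathcal H$ is generated by $A,B$ this determines it). *)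

theory Defs
  imports Complex_Main "HOL-Library.Poly_Mapping"
begin

section \<open>Complex vector spaces and complex algebras\<close>

class complex_vector = ab_group_add +
  fixes scaleC :: "complex \<Rightarrow> 'a \<Rightarrow> 'a"  (infixr \<open>*\<^sub>C\<close> 75)
  assumes scaleC_add_right: "c *\<^sub>C (x + y) = c *\<^sub>C x + c *\<^sub>C y"
    and scaleC_add_left: "(c + d) *\<^sub>C x = c *\<^sub>C x + d *\<^sub>C x"
    and scaleC_scaleC [simp]: "c *\<^sub>C d *\<^sub>C x = (c * d) *\<^sub>C x"
    and scaleC_one [simp]: "1 *\<^sub>C x = x"

global_interpretation complex_vector: vector_space "scaleC :: complex \<Rightarrow> 'a \<Rightarrow> 'a::complex_vector"
  by unfold_locales (simp_all add: scaleC_add_right scaleC_add_left)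

abbreviation cspan :: "'a::complex_vector set \<Rightarrow> 'a set" where
  "cspan \<equiv> module.span scaleC"

abbreviation csubspace :: "'a::complex_vector set \<Rightarrow> bool" where
  "csubspace \<equiv> module.subspace scaleC"

abbreviation clinear :: "('a::complex_vector \<Rightarrow> 'b::complex_vector) \<Rightarrow> bool" where
  "clinear \<equiv> Vector_Spaces.linear scaleC scaleC"

lemma clinearI:
  assumes "\<And>x y. f (x + y) = f x + f y" and "\<And>c x. f (c *\<^sub>C x) = c *\<^sub>C f x"
  shows "clinear f"
  by unfold_locales (use assms in auto)

lemma clinear_add: "clinear f \<Longrightarrow> f (x + y) = f x + f y"
  by (rule module_hom.add[OF Vector_Spaces.linear.axioms(3)])

lemma clinear_scale: "clinear f \<Longrightarrow> f (c *\<^sub>C x) = c *\<^sub>C f x"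
  by (rule module_hom.scale[OF Vector_Spaces.linear.axioms(3)])

lemma clinear_diff: "clinear f \<Longrightarrow> f (x - y) = f x - f y"
  by (rule module_hom.diff[OF Vector_Spaces.linear.axioms(3)])

lemma clinear_zero: "clinear f \<Longrightarrow> f 0 = 0"
  by (rule module_hom.zero[OF Vector_Spaces.linear.axioms(3)])

text \<open>Unital associative algebras over the complex numbers; the zero algebra is allowed.\<close>

class complex_algebra = complex_vector + ring + monoid_mult +
  assumes mult_scaleC_left [simp]: "(c *\<^sub>C x) * y = c *\<^sub>C (x * y)"
    and mult_scaleC_right [simp]: "x * (c *\<^sub>C y) = c *\<^sub>C (x * y)"

definition algebra_hom :: "('a::complex_algebra \<Rightarrow> 'b::complex_algebra) \<Rightarrow> bool" where
  "algebra_hom f \<longleftrightarrow> clinear f \<and> (\<forall>x y. f (x * y) = f x * f y) \<and> f 1 = 1"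

definition commutator :: "'a::ring \<Rightarrow> 'a \<Rightarrow> 'a" where
  "commutator x y = x * y - y * x"

instantiation complex :: complex_vector
begin
definition scaleC_complex :: "complex \<Rightarrow> complex \<Rightarrow> complex" where "scaleC_complex = (*)"
instance by standard (simp_all add: scaleC_complex_def algebra_simps)
end

instantiation poly_mapping :: (type, complex_vector) complex_vector
begin
lift_definition scaleC_poly_mapping :: "complex \<Rightarrow> ('a \<Rightarrow>\<^sub>0 'b) \<Rightarrow> ('a \<Rightarrow>\<^sub>0 'b)"
  is "\<lambda>c p i. c *\<^sub>C p i"
proof -
  fix c and p :: "'a \<Rightarrow> 'b"
  assume "finite {i. p i \<noteq> 0}"
  then show "finite {i. c *\<^sub>C p i \<noteq> 0}"
    by (rule rev_finite_subset) auto
qed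
instance
  by standard (transfer; simp add: scaleC_add_right scaleC_add_left)+
end

section \<open>Linear endomorphisms\<close>

typedef (overloaded) 'v endo = "{f :: 'v::complex_vector \<Rightarrow> 'v. clinear f}"
  morphisms endo_apply Abs_endo
  by (rule exI[of _ "\<lambda>x. x"]) (simp add: clinearI)

setup_lifting type_definition_endo

instantiation endo :: (complex_vector) complex_algebra
begin
lift_definition zero_endo :: "'a endo" is "\<lambda>_. 0" by (rule clinearI) auto
lift_definition one_endo :: "'a endo" is "\<lambda>v. v" by (rule clinearI) auto
lift_definition plus_endo :: "'a endo \<Rightarrow> 'a endo \<Rightarrow> 'a endo" is "\<lambda>f g v. f v + g v"
  by (rule clinearI) (auto simp: clinear_add clinear_scale scaleC_add_right)
lift_definition minus_endo :: "'a endo \<Rightarrow> 'a endo \<Rightarrow> 'a endo" is "\<lambda>f g v. f v - g v"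
  by (rule clinearI)
    (auto simp: clinear_add clinear_scale complex_vector.scale_right_diff_distrib)
lift_definition uminus_endo :: "'a endo \<Rightarrow> 'a endo" is "\<lambda>f v. - f v"
  by (rule clinearI) (auto simp: clinear_add clinear_scale)
lift_definition times_endo :: "'a endo \<Rightarrow> 'a endo \<Rightarrow> 'a endo" is "\<lambda>f g v. f (g v)"
  by (rule clinearI) (auto simp: clinear_add clinear_scale)
lift_definition scaleC_endo :: "complex \<Rightarrow> 'a endo \<Rightarrow> 'a endo" is "\<lambda>c f v. c *\<^sub>C f v"
  by (rule clinearI) (auto simp: clinear_add clinear_scale scaleC_add_right mult.commute)
instance
  by standard
    (transfer; simp add: fun_eq_iff scaleC_add_right scaleC_add_left clinear_add clinear_scale
      algebra_simps)+
end

text \<open>The linear map out of the free vector space with prescribed values on the basis.\<close>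

definition linear_extension :: "('i \<Rightarrow> 'v::complex_vector) \<Rightarrow> ('i \<Rightarrow>\<^sub>0 complex) \<Rightarrow> 'v" where
  "linear_extension f p = (\<Sum>i\<in>Poly_Mapping.keys p. Poly_Mapping.lookup p i *\<^sub>C f i)"

abbreviation basis_vec :: "'i \<Rightarrow> ('i \<Rightarrow>\<^sub>0 complex)" where
  "basis_vec i \<equiv> Poly_Mapping.single i 1"

lemma linear_extension_superset:
  assumes "finite S" "Poly_Mapping.keys p \<subseteq> S"
  shows "linear_extension f p = (\<Sum>i\<in>S. Poly_Mapping.lookup p i *\<^sub>C f i)"
  unfolding linear_extension_def
  by (rule sum.mono_neutral_left) (use assms in \<open>auto simp: in_keys_iff\<close>)

lemma clinear_linear_extension: "clinear (linear_extension f)"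
proof (rule clinearI)
  fix p q :: "'a \<Rightarrow>\<^sub>0 complex"
  let ?S = "Poly_Mapping.keys p \<union> Poly_Mapping.keys q"
  have "linear_extension f (p + q) = (\<Sum>i\<in>?S. Poly_Mapping.lookup (p + q) i *\<^sub>C f i)"
    by (rule linear_extension_superset) (auto simp: keys_add)
  also have "\<dots> = (\<Sum>i\<in>?S. Poly_Mapping.lookup p i *\<^sub>C f i)
      + (\<Sum>i\<in>?S. Poly_Mapping.lookup q i *\<^sub>C f i)"
    by (simp add: lookup_add scaleC_add_left sum.distrib)
  also have "\<dots> = linear_extension f p + linear_extension f q"
    by (simp add: linear_extension_superset[of ?S])
  finally show "linear_extension f (p + q) = linear_extension f p + linear_extension f q" .
next
  fix c and p :: "'a \<Rightarrow>\<^sub>0 complex"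
  have "linear_extension f (c *\<^sub>C p)
      = (\<Sum>i\<in>Poly_Mapping.keys p. Poly_Mapping.lookup (c *\<^sub>C p) i *\<^sub>C f i)"
    by (rule linear_extension_superset)
      (auto simp: in_keys_iff scaleC_poly_mapping.rep_eq scaleC_complex_def)
  then show "linear_extension f (c *\<^sub>C p) = c *\<^sub>C linear_extension f p"
    by (simp add: linear_extension_def complex_vector.scale_sum_right
        scaleC_poly_mapping.rep_eq scaleC_complex_def)
qed

lemma linear_extension_basis_vec [simp]: "linear_extension f (basis_vec i) = f i"
  by (simp add: linear_extension_def)

lemma free_space_induct [case_names basis add scale]:
  assumes basis: "\<And>i. P (basis_vec i)"
    and add: "\<And>p q. P p \<Longrightarrow> P q \<Longrightarrow> P (p + q)"
    and scale: "\<And>c p. P p \<Longrightarrow> P (c *\<^sub>C p)"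
  shows "P p"
proof (induction p rule: update_induct)
  case const
  show ?case using scale[OF basis, of 0] by simp
next
  case (update p i c)
  have "Poly_Mapping.update i c p = p + c *\<^sub>C basis_vec i"
    using update(1)
    by (intro poly_mapping_eqI)
      (auto simp: lookup_update lookup_add lookup_single scaleC_poly_mapping.rep_eq
        scaleC_complex_def when_def in_keys_iff)
  then show ?case using update(3) add scale basis by simp
qed

definition linear_endo ::
  "('i \<Rightarrow> ('i \<Rightarrow>\<^sub>0 complex)) \<Rightarrow> ('i \<Rightarrow>\<^sub>0 complex) endo" where
  "linear_endo f = Abs_endo (linear_extension f)"

lemma endo_apply_linear_endo [simp]: "endo_apply (linear_endo f) = linear_extension f"
  by (simp add: linear_endo_def Abs_endo_inverse clinear_linear_extension)

section \<open>Algebras given by generators and relations\<close>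

datatype 'g alg_expr =
    Gen 'g
  | Const complex
  | Add "'g alg_expr" "'g alg_expr"
  | Mul "'g alg_expr" "'g alg_expr"

abbreviation Scale :: "complex \<Rightarrow> 'g alg_expr \<Rightarrow> 'g alg_expr" where
  "Scale c x \<equiv> Mul (Const c) x"

abbreviation Comm :: "'g alg_expr \<Rightarrow> 'g alg_expr \<Rightarrow> 'g alg_expr" where
  "Comm x y \<equiv> Add (Mul x y) (Scale (- 1) (Mul y x))"

text \<open>A pair \<open>(x, y)\<close> of expressions stands for the defining relation \<open>x = y\<close>.\<close>

class presentation =
  fixes relations :: "('a alg_expr \<times> 'a alg_expr) set"

inductive alg_cong :: "'g::presentation alg_expr \<Rightarrow> 'g alg_expr \<Rightarrow> bool" where
  cong_relation: "(x, y) \<in> relations \<Longrightarrow> alg_cong x y"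
| cong_refl: "alg_cong x x"
| cong_sym: "alg_cong x y \<Longrightarrow> alg_cong y x"
| cong_trans: "alg_cong x y \<Longrightarrow> alg_cong y z \<Longrightarrow> alg_cong x z"
| cong_Add_cong: "alg_cong x x' \<Longrightarrow> alg_cong y y' \<Longrightarrow> alg_cong (Add x y) (Add x' y')"
| cong_Mul_cong: "alg_cong x x' \<Longrightarrow> alg_cong y y' \<Longrightarrow> alg_cong (Mul x y) (Mul x' y')"
| cong_Add_assoc: "alg_cong (Add (Add x y) z) (Add x (Add y z))"
| cong_Add_comm: "alg_cong (Add x y) (Add y x)"
| cong_Add_zero: "alg_cong (Add (Const 0) x) x"
| cong_Add_minus: "alg_cong (Add (Scale (- 1) x) x) (Const 0)"
| cong_Mul_assoc: "alg_cong (Mul (Mul x y) z) (Mul x (Mul y z))"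
| cong_Mul_one: "alg_cong (Mul (Const 1) x) x"
| cong_distrib_right: "alg_cong (Mul (Add x y) z) (Add (Mul x z) (Mul y z))"
| cong_distrib_left: "alg_cong (Mul x (Add y z)) (Add (Mul x y) (Mul x z))"
| cong_Const_add: "alg_cong (Const (c + d)) (Add (Const c) (Const d))"
| cong_Const_mult: "alg_cong (Const (c * d)) (Mul (Const c) (Const d))"
| cong_Const_central: "alg_cong (Mul (Const c) x) (Mul x (Const c))"

quotient_type (overloaded) 'g presented = "'g::presentation alg_expr" / alg_cong
  by (rule equivpI) (auto simp: reflp_def symp_def transp_def intro: alg_cong.intros)

lift_definition gen :: "'g::presentation \<Rightarrow> 'g presented" is Gen .

instantiation presented :: (presentation) complex_algebra
begin
lift_definition zero_presented :: "'a presented" is "Const 0" .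
lift_definition one_presented :: "'a presented" is "Const 1" .
lift_definition plus_presented :: "'a presented \<Rightarrow> 'a presented \<Rightarrow> 'a presented" is Add
  by (rule cong_Add_cong)
lift_definition times_presented :: "'a presented \<Rightarrow> 'a presented \<Rightarrow> 'a presented" is Mul
  by (rule cong_Mul_cong)
lift_definition uminus_presented :: "'a presented \<Rightarrow> 'a presented" is "Scale (- 1)"
  by (intro cong_Mul_cong cong_refl)
lift_definition minus_presented :: "'a presented \<Rightarrow> 'a presented \<Rightarrow> 'a presented"
  is "\<lambda>x y. Add x (Scale (- 1) y)"
  by (intro cong_Add_cong cong_Mul_cong cong_refl)
lift_definition scaleC_presented :: "complex \<Rightarrow> 'a presented \<Rightarrow> 'a presented" is Scale
  by (intro cong_Mul_cong cong_refl)
instance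
proof
  fix x y z :: "'a presented" and c d :: complex
  show "x + y + z = x + (y + z)" by transfer (rule cong_Add_assoc)
  show "x + y = y + x" by transfer (rule cong_Add_comm)
  show "0 + x = x" by transfer (rule cong_Add_zero)
  show "- x + x = 0" by transfer (rule cong_Add_minus)
  show "x - y = x + - y" by transfer (rule cong_refl)
  show "x * y * z = x * (y * z)" by transfer (rule cong_Mul_assoc)
  show "1 * x = x" by transfer (rule cong_Mul_one)
  show "x * 1 = x"
    by transfer (rule cong_trans[OF cong_sym[OF cong_Const_central] cong_Mul_one])
  show "(x + y) * z = x * z + y * z" by transfer (rule cong_distrib_right)
  show "x * (y + z) = x * y + x * z" by transfer (rule cong_distrib_left)
  show "c *\<^sub>C (x + y) = c *\<^sub>C x + c *\<^sub>C y" by transfer (rule cong_distrib_left)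
  show "(c + d) *\<^sub>C x = c *\<^sub>C x + d *\<^sub>C x"
    by transfer (rule cong_trans[OF cong_Mul_cong[OF cong_Const_add cong_refl]
          cong_distrib_right])
  show "c *\<^sub>C d *\<^sub>C x = (c * d) *\<^sub>C x"
    by transfer (rule cong_sym[OF cong_trans[OF
            cong_Mul_cong[OF cong_Const_mult cong_refl] cong_Mul_assoc]])
  show "1 *\<^sub>C x = x" by transfer (rule cong_Mul_one)
  show "c *\<^sub>C x * y = c *\<^sub>C (x * y)" by transfer (rule cong_Mul_assoc)
  show "x * c *\<^sub>C y = c *\<^sub>C (x * y)"
    by transfer (meson cong_Mul_assoc cong_Mul_cong cong_Const_central
        cong_refl cong_sym cong_trans)
qed
end

primrec alg_eval :: "('g \<Rightarrow> 'b::complex_algebra) \<Rightarrow> 'g alg_expr \<Rightarrow> 'b" where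
  "alg_eval f (Gen g) = f g"
| "alg_eval f (Const c) = c *\<^sub>C 1"
| "alg_eval f (Add x y) = alg_eval f x + alg_eval f y"
| "alg_eval f (Mul x y) = alg_eval f x * alg_eval f y"

definition satisfies_relations :: "('g::presentation \<Rightarrow> 'b::complex_algebra) \<Rightarrow> bool" where
  "satisfies_relations f \<longleftrightarrow> (\<forall>(x, y)\<in>relations. alg_eval f x = alg_eval f y)"

text \<open>The algebra homomorphism with prescribed values on the generators. The choice of the
  representative is immaterial as soon as the values satisfy the defining relations, see
  \<open>algebra_hom_presented_lift\<close> and \<open>presented_lift_gen\<close>.\<close>

definition presented_lift ::
  "('g::presentation \<Rightarrow> 'b::complex_algebra) \<Rightarrow> 'g presented \<Rightarrow> 'b" where
  "presented_lift f x = alg_eval f (rep_presented x)"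

lemma alg_eval_cong:
  assumes "alg_cong x y" and f: "satisfies_relations f"
  shows "alg_eval f x = alg_eval f y"
  using assms(1)
proof induction
  case (cong_relation x y)
  then show ?case using f by (auto simp: satisfies_relations_def)
qed (auto simp: algebra_simps scaleC_add_left)

lemma presented_lift_abs:
  assumes "satisfies_relations f"
  shows "presented_lift f (abs_presented x) = alg_eval f x"
  unfolding presented_lift_def
  by (rule alg_eval_cong[OF _ assms])
    (metis Quotient3_presented Quotient3_rep_abs cong_refl)

lemma presented_lift_gen:
  "satisfies_relations f \<Longrightarrow> presented_lift f (gen g) = f g"
  by (simp add: gen.abs_eq presented_lift_abs)

lemma algebra_hom_presented_lift:
  assumes f: "satisfies_relations f"
  shows "algebra_hom (presented_lift f)"
proof -
  have ex: "\<exists>x'. x = abs_presented x'" for x :: "'a presented"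
    by (metis Quotient3_abs_rep Quotient3_presented)
  have add: "presented_lift f (x + y) = presented_lift f x + presented_lift f y" for x y
    using ex[of x] ex[of y] by (auto simp: plus_presented.abs_eq presented_lift_abs[OF f])
  have mult: "presented_lift f (x * y) = presented_lift f x * presented_lift f y" for x y
    using ex[of x] ex[of y] by (auto simp: times_presented.abs_eq presented_lift_abs[OF f])
  have scale: "presented_lift f (c *\<^sub>C x) = c *\<^sub>C presented_lift f x" for c x
    using ex[of x] by (auto simp: scaleC_presented.abs_eq presented_lift_abs[OF f])
  have one: "presented_lift f 1 = 1"
    by (simp add: one_presented.abs_eq presented_lift_abs[OF f])
  show ?thesis
    unfolding algebra_hom_def using add mult scale one by (auto intro: clinearI)
qed

section \<open>Tensor products\<close>

text \<open>The free vector space on the pairs, modulo the subspace of the bilinearity relations.\<close>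

definition bilinear_relations ::
  "(('a::complex_vector \<times> 'b::complex_vector) \<Rightarrow>\<^sub>0 complex) set" where
  "bilinear_relations =
     {basis_vec (x + x', y) - basis_vec (x, y) - basis_vec (x', y) | x x' y. True}
   \<union> {basis_vec (x, y + y') - basis_vec (x, y) - basis_vec (x, y') | x y y'. True}
   \<union> {basis_vec (c *\<^sub>C x, y) - c *\<^sub>C basis_vec (x, y) | c x y. True}
   \<union> {basis_vec (x, c *\<^sub>C y) - c *\<^sub>C basis_vec (x, y) | c x y. True}"

definition tensor_rel ::
  "(('a::complex_vector \<times> 'b::complex_vector) \<Rightarrow>\<^sub>0 complex) \<Rightarrow> (('a \<times> 'b) \<Rightarrow>\<^sub>0 complex) \<Rightarrow> bool"
  where "tensor_rel p q \<longleftrightarrow> p - q \<in> cspan bilinear_relations"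

quotient_type (overloaded) ('a, 'b) tensor =
  "('a::complex_vector \<times> 'b::complex_vector) \<Rightarrow>\<^sub>0 complex" / tensor_rel
proof (rule equivpI)
  show "reflp tensor_rel"
    by (simp add: reflp_def tensor_rel_def complex_vector.span_zero)
  show "symp tensor_rel"
    unfolding symp_def tensor_rel_def
    by (intro allI impI, drule complex_vector.span_neg) simp
  show "transp tensor_rel"
    unfolding transp_def tensor_rel_def
    by (intro allI impI, drule (1) complex_vector.span_add) simp
qed

instantiation tensor :: (complex_vector, complex_vector) complex_vector
begin
lift_definition zero_tensor :: "('a, 'b) tensor" is 0 .
lift_definition plus_tensor :: "('a, 'b) tensor \<Rightarrow> ('a, 'b) tensor \<Rightarrow> ('a, 'b) tensor" is "(+)"
  unfolding tensor_rel_def by (drule (1) complex_vector.span_add) (simp add: algebra_simps)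
lift_definition minus_tensor :: "('a, 'b) tensor \<Rightarrow> ('a, 'b) tensor \<Rightarrow> ('a, 'b) tensor" is "(-)"
  unfolding tensor_rel_def
  by (drule (1) complex_vector.span_diff) (simp add: algebra_simps)
lift_definition uminus_tensor :: "('a, 'b) tensor \<Rightarrow> ('a, 'b) tensor" is uminus
  unfolding tensor_rel_def
  by (drule complex_vector.span_neg) (simp add: algebra_simps)
lift_definition scaleC_tensor :: "complex \<Rightarrow> ('a, 'b) tensor \<Rightarrow> ('a, 'b) tensor" is scaleC
  unfolding tensor_rel_def
  by (drule complex_vector.span_scale) (simp add: complex_vector.scale_right_diff_distrib)
instance
  by standard
    (transfer; simp add: tensor_rel_def complex_vector.span_zero scaleC_add_right
      scaleC_add_left algebra_simps)+
end

lift_definition tensor_pure ::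
  "'a::complex_vector \<Rightarrow> 'b::complex_vector \<Rightarrow> ('a, 'b) tensor"  (infixr \<open>\<otimes>\<^sub>t\<close> 76)
  is "\<lambda>x y. basis_vec (x, y)" .

definition cbilinear ::
  "('a::complex_vector \<Rightarrow> 'b::complex_vector \<Rightarrow> 'c::complex_vector) \<Rightarrow> bool" where
  "cbilinear f \<longleftrightarrow> (\<forall>y. clinear (\<lambda>x. f x y)) \<and> (\<forall>x. clinear (f x))"

text \<open>The linear map on the tensor product induced by a bilinear map. The choice of the
  representative is immaterial for bilinear maps, see \<open>tensor_lift_abs\<close>.\<close>

definition tensor_lift ::
  "('a::complex_vector \<Rightarrow> 'b::complex_vector \<Rightarrow> 'c::complex_vector) \<Rightarrow> ('a, 'b) tensor \<Rightarrow> 'c" where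
  "tensor_lift f t = linear_extension (\<lambda>(x, y). f x y) (rep_tensor t)"

lemma cbilinearI:
  assumes "\<And>x x' y. f (x + x') y = f x y + f x' y" "\<And>c x y. f (c *\<^sub>C x) y = c *\<^sub>C f x y"
    "\<And>x y y'. f x (y + y') = f x y + f x y'" "\<And>c x y. f x (c *\<^sub>C y) = c *\<^sub>C f x y"
  shows "cbilinear f"
  unfolding cbilinear_def using assms by (auto intro!: clinearI)

lemma cbilinearD:
  assumes "cbilinear f"
  shows "f (x + x') y = f x y + f x' y" "f (c *\<^sub>C x) y = c *\<^sub>C f x y"
    "f x (y + y') = f x y + f x y'" "f x (c *\<^sub>C y) = c *\<^sub>C f x y"
  using assms clinear_add[of "\<lambda>x. f x y"] clinear_scale[of "\<lambda>x. f x y"]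
    clinear_add[of "f x"] clinear_scale[of "f x"]
  unfolding cbilinear_def by auto

lemma linear_extension_bilinear_relations:
  assumes f: "cbilinear f" and p: "p \<in> cspan bilinear_relations"
  shows "linear_extension (\<lambda>(x, y). f x y) p = 0"
  using p
proof (induction rule: complex_vector.span_induct_alt)
  case base
  show ?case by (rule clinear_zero[OF clinear_linear_extension])
next
  case (step c r q)
  have "linear_extension (\<lambda>(x, y). f x y) r = 0"
    using step(1)
    by (auto simp: bilinear_relations_def clinear_diff[OF clinear_linear_extension]
        clinear_scale[OF clinear_linear_extension] cbilinearD[OF f])
  then show ?case
    using step by (simp add: clinear_add[OF clinear_linear_extension]
        clinear_scale[OF clinear_linear_extension])
qed

lemma tensor_lift_abs:
  assumes f: "cbilinear f"
  shows "tensor_lift f (abs_tensor p) = linear_extension (\<lambda>(x, y). f x y) p"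
proof -
  have "tensor_rel p p" by (simp add: tensor_rel_def complex_vector.span_zero)
  then have "tensor_rel (rep_tensor (abs_tensor p)) p"
    by (metis Quotient3_tensor Quotient3_rep_abs)
  then have "linear_extension (\<lambda>(x, y). f x y) (rep_tensor (abs_tensor p) - p) = 0"
    unfolding tensor_rel_def by (rule linear_extension_bilinear_relations[OF f])
  then show ?thesis
    by (simp add: tensor_lift_def clinear_diff[OF clinear_linear_extension])
qed

lemma tensor_lift_pure: "cbilinear f \<Longrightarrow> tensor_lift f (x \<otimes>\<^sub>t y) = f x y"
  by (simp add: tensor_pure.abs_eq tensor_lift_abs)

lemma abs_tensor_ex: "\<exists>p. t = abs_tensor p"
  by (metis Quotient3_abs_rep Quotient3_tensor)

lemma clinear_tensor_lift:
  assumes f: "cbilinear f"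
  shows "clinear (tensor_lift f)"
proof (rule clinearI)
  fix s t :: "('a, 'b) tensor" and c
  show "tensor_lift f (s + t) = tensor_lift f s + tensor_lift f t"
    using abs_tensor_ex[of s] abs_tensor_ex[of t]
    by (auto simp: plus_tensor.abs_eq tensor_lift_abs[OF f] clinear_add[OF clinear_linear_extension])
  show "tensor_lift f (c *\<^sub>C t) = c *\<^sub>C tensor_lift f t"
    using abs_tensor_ex[of t]
    by (auto simp: scaleC_tensor.abs_eq tensor_lift_abs[OF f]
        clinear_scale[OF clinear_linear_extension])
qed

lemma cbilinear_tensor_pure: "cbilinear (\<otimes>\<^sub>t)"
proof (rule cbilinearI)
  fix x x' :: 'a and y y' :: 'b and c :: complex
  show "(x + x') \<otimes>\<^sub>t y = x \<otimes>\<^sub>t y + x' \<otimes>\<^sub>t y"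
    by transfer (unfold tensor_rel_def diff_diff_add[symmetric],
        rule complex_vector.span_base, unfold bilinear_relations_def, blast)
  show "x \<otimes>\<^sub>t (y + y') = x \<otimes>\<^sub>t y + x \<otimes>\<^sub>t y'"
    by transfer (unfold tensor_rel_def diff_diff_add[symmetric],
        rule complex_vector.span_base, unfold bilinear_relations_def, blast)
  show "(c *\<^sub>C x) \<otimes>\<^sub>t y = c *\<^sub>C (x \<otimes>\<^sub>t y)"
    by transfer (unfold tensor_rel_def,
        rule complex_vector.span_base, unfold bilinear_relations_def, blast)
  show "x \<otimes>\<^sub>t (c *\<^sub>C y) = c *\<^sub>C (x \<otimes>\<^sub>t y)"
    by transfer (unfold tensor_rel_def,
        rule complex_vector.span_base, unfold bilinear_relations_def, blast)
qed

lemmas tensor_pure_simps = cbilinearD[OF cbilinear_tensor_pure]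

lemma tensor_induct [case_names pure add scale]:
  assumes pure: "\<And>x y. P (x \<otimes>\<^sub>t y)"
    and add: "\<And>s t. P s \<Longrightarrow> P t \<Longrightarrow> P (s + t)"
    and scale: "\<And>c t. P t \<Longrightarrow> P (c *\<^sub>C t)"
  shows "P (t :: ('a::complex_vector, 'b::complex_vector) tensor)"
proof -
  have "P (abs_tensor p)" for p :: "('a \<times> 'b) \<Rightarrow>\<^sub>0 complex"
  proof (induction p rule: free_space_induct)
    case (basis z)
    then show ?case using pure by (cases z) (simp add: tensor_pure.abs_eq)
  qed (simp_all add: add scale flip: plus_tensor.abs_eq scaleC_tensor.abs_eq)
  then show ?thesis using abs_tensor_ex[of t] by auto
qed

instantiation tensor :: (complex_algebra, complex_algebra) complex_algebra
begin
definition one_tensor :: "('a, 'b) tensor" where "one_tensor = 1 \<otimes>\<^sub>t 1"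
definition times_tensor :: "('a, 'b) tensor \<Rightarrow> ('a, 'b) tensor \<Rightarrow> ('a, 'b) tensor" where
  "times_tensor s t = tensor_lift (\<lambda>x y. tensor_lift (\<lambda>x' y'. (x * x') \<otimes>\<^sub>t (y * y')) t) s"

lemma cbilinear_times_inner:
  "cbilinear (\<lambda>x' y'. (x * x') \<otimes>\<^sub>t (y * y') :: ('a, 'b) tensor)"
  by (rule cbilinearI) (simp_all add: tensor_pure_simps distrib_left)

lemma tensor_lift_times_inner:
  "tensor_lift (\<lambda>x' y'. (x * x') \<otimes>\<^sub>t (y * y') :: ('a, 'b) tensor) (u \<otimes>\<^sub>t v) = (x * u) \<otimes>\<^sub>t (y * v)"
  by (rule tensor_lift_pure[OF cbilinear_times_inner])

lemma cbilinear_times_outer: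
  "cbilinear (\<lambda>x y. tensor_lift (\<lambda>x' y'. (x * x') \<otimes>\<^sub>t (y * y') :: ('a, 'b) tensor) t)"
proof (induction t rule: tensor_induct)
  case (pure u v)
  show ?case
    unfolding tensor_lift_times_inner
    by (rule cbilinearI) (simp_all add: tensor_pure_simps distrib_right)
next
  case (add s t)
  show ?case
    unfolding clinear_add[OF clinear_tensor_lift[OF cbilinear_times_inner]]
    by (rule cbilinearI)
      (simp_all del: mult_scaleC_left add: cbilinearD[OF add(1)] cbilinearD[OF add(2)] scaleC_add_right)
next
  case (scale c t)
  show ?case
    unfolding clinear_scale[OF clinear_tensor_lift[OF cbilinear_times_inner]]
    by (rule cbilinearI)
      (simp_all del: mult_scaleC_left add: cbilinearD[OF scale] scaleC_add_right mult.commute)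
qed

lemma tensor_pure_times:
  "(x \<otimes>\<^sub>t y) * t = tensor_lift (\<lambda>x' y'. (x * x') \<otimes>\<^sub>t (y * y') :: ('a, 'b) tensor) t"
  unfolding times_tensor_def by (rule tensor_lift_pure[OF cbilinear_times_outer])

lemma tensor_pure_mult:
  "(x \<otimes>\<^sub>t y) * (x' \<otimes>\<^sub>t y') = ((x * x') \<otimes>\<^sub>t (y * y') :: ('a, 'b) tensor)"
  unfolding tensor_pure_times by (rule tensor_lift_times_inner)

lemma clinear_times_tensor_left: "clinear (\<lambda>s :: ('a, 'b) tensor. s * t)"
  unfolding times_tensor_def by (rule clinear_tensor_lift[OF cbilinear_times_outer])

lemma clinear_times_tensor_right: "clinear (\<lambda>t :: ('a, 'b) tensor. s * t)"
proof (induction s rule: tensor_induct)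
  case (pure x y)
  show ?case
    unfolding tensor_pure_times by (rule clinear_tensor_lift[OF cbilinear_times_inner])
next
  case (add s s')
  show ?case
    by (rule clinearI)
      (simp_all add: clinear_add[OF clinear_times_tensor_left] clinear_add[OF add(1)]
        clinear_add[OF add(2)] clinear_scale[OF add(1)] clinear_scale[OF add(2)] scaleC_add_right)
next
  case (scale c s)
  show ?case
    by (rule clinearI)
      (simp_all add: clinear_scale[OF clinear_times_tensor_left] clinear_add[OF scale]
        clinear_scale[OF scale] scaleC_add_right mult.commute)
qed

instance
proof
  note lin = clinear_add[OF clinear_times_tensor_left] clinear_scale[OF clinear_times_tensor_left]
    clinear_add[OF clinear_times_tensor_right] clinear_scale[OF clinear_times_tensor_right]
  fix r s t :: "('a, 'b) tensor" and c :: complex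
  show "r * s * t = r * (s * t)"
  proof (induction r rule: tensor_induct)
    case (pure x y)
    show ?case
    proof (induction s rule: tensor_induct)
      case (pure x' y')
      show ?case
        by (induction t rule: tensor_induct) (simp_all add: lin tensor_pure_mult mult.assoc)
    qed (simp_all add: lin)
  qed (simp_all add: lin)
  show "(r + s) * t = r * t + s * t" "r * (s + t) = r * s + r * t"
    "c *\<^sub>C s * t = c *\<^sub>C (s * t)" "s * c *\<^sub>C t = c *\<^sub>C (s * t)"
    by (simp_all add: lin)
  show "1 * t = t"
    by (induction t rule: tensor_induct) (simp_all add: lin one_tensor_def tensor_pure_mult)
  show "t * 1 = t"
    by (induction t rule: tensor_induct) (simp_all add: lin one_tensor_def tensor_pure_mult)
qed
end

section \<open>Modules\<close>

locale algebra_module =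
  fixes V :: "'v::complex_vector set" and act :: "'r::complex_algebra \<Rightarrow> 'v \<Rightarrow> 'v"
  assumes carrier_subspace: "csubspace V"
    and act_closed: "v \<in> V \<Longrightarrow> act x v \<in> V"
    and act_add_right: "v \<in> V \<Longrightarrow> w \<in> V \<Longrightarrow> act x (v + w) = act x v + act x w"
    and act_scale_right: "v \<in> V \<Longrightarrow> act x (c *\<^sub>C v) = c *\<^sub>C act x v"
    and act_add_left: "v \<in> V \<Longrightarrow> act (x + y) v = act x v + act y v"
    and act_scale_left: "v \<in> V \<Longrightarrow> act (c *\<^sub>C x) v = c *\<^sub>C act x v"
    and act_mult: "v \<in> V \<Longrightarrow> act (x * y) v = act x (act y v)"
    and act_one: "v \<in> V \<Longrightarrow> act 1 v = v"

definition submodule ::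
  "'v::complex_vector set \<Rightarrow> 'v set \<Rightarrow> ('r::complex_algebra \<Rightarrow> 'v \<Rightarrow> 'v) \<Rightarrow> bool" where
  "submodule W V act \<longleftrightarrow> csubspace W \<and> W \<subseteq> V \<and> (\<forall>x. \<forall>w\<in>W. act x w \<in> W)"

definition irreducible_module ::
  "'v::complex_vector set \<Rightarrow> ('r::complex_algebra \<Rightarrow> 'v \<Rightarrow> 'v) \<Rightarrow> bool" where
  "irreducible_module V act \<longleftrightarrow> algebra_module V act \<and> V \<noteq> {0}
     \<and> (\<forall>W. submodule W V act \<longrightarrow> W = {0} \<or> W = V)"

definition isomorphic_modules ::
  "'v::complex_vector set \<Rightarrow> ('r::complex_algebra \<Rightarrow> 'v \<Rightarrow> 'v)
    \<Rightarrow> 'w::complex_vector set \<Rightarrow> ('r \<Rightarrow> 'w \<Rightarrow> 'w) \<Rightarrow> bool" where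
  "isomorphic_modules V act W act' \<longleftrightarrow> algebra_module V act \<and> algebra_module W act'
     \<and> (\<exists>f. bij_betw f V W
          \<and> (\<forall>u\<in>V. \<forall>v\<in>V. f (u + v) = f u + f v)
          \<and> (\<forall>c. \<forall>v\<in>V. f (c *\<^sub>C v) = c *\<^sub>C f v)
          \<and> (\<forall>x. \<forall>v\<in>V. f (act x v) = act' x (f v)))"

definition endo_tensor ::
  "'v::complex_vector endo \<Rightarrow> 'w::complex_vector endo \<Rightarrow> ('v, 'w) tensor endo" where
  "endo_tensor f g = Abs_endo (tensor_lift (\<lambda>v w. endo_apply f v \<otimes>\<^sub>t endo_apply g w))"

text \<open>The componentwise action \<open>(x \<otimes> y)(v \<otimes> w) = xv \<otimes> yw\<close>.\<close>

definition tensor_action ::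
  "('r::complex_algebra \<Rightarrow> 'v::complex_vector endo) \<Rightarrow> ('s::complex_algebra \<Rightarrow> 'w::complex_vector endo)
    \<Rightarrow> ('r, 's) tensor \<Rightarrow> ('v, 'w) tensor endo" where
  "tensor_action \<rho> \<sigma> = tensor_lift (\<lambda>x y. endo_tensor (\<rho> x) (\<sigma> y))"

definition tensor_space ::
  "'v::complex_vector set \<Rightarrow> 'w::complex_vector set \<Rightarrow> ('v, 'w) tensor set" where
  "tensor_space V W = cspan {v \<otimes>\<^sub>t w | v w. v \<in> V \<and> w \<in> W}"

text \<open>The space with basis \<open>v\<^sub>0, \<dots>, v\<^sub>n\<close>, where \<open>v\<^sub>i\<close> is \<open>basis_vec i\<close>.\<close>

definition coord_space :: "nat \<Rightarrow> (nat \<Rightarrow>\<^sub>0 complex) set" where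
  "coord_space n = cspan (basis_vec ` {..n})"

section \<open>The universal enveloping algebra of \<open>sl\<^sub>2\<close>\<close>

datatype sl2_gen = Egen | Fgen | Hgen

instantiation sl2_gen :: presentation
begin
definition relations_sl2_gen :: "(sl2_gen alg_expr \<times> sl2_gen alg_expr) set" where
  "relations_sl2_gen =
    {(Comm (Gen Hgen) (Gen Egen), Scale 2 (Gen Egen)),
     (Comm (Gen Hgen) (Gen Fgen), Scale (- 2) (Gen Fgen)),
     (Comm (Gen Egen) (Gen Fgen), Gen Hgen)}"
instance ..
end

type_synonym usl2 = "sl2_gen presented"

definition sl2_E :: usl2 where "sl2_E = gen Egen"
definition sl2_F :: usl2 where "sl2_F = gen Fgen"
definition sl2_H :: usl2 where "sl2_H = gen Hgen"

definition sl2_Casimir :: usl2 where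
  "sl2_Casimir = sl2_E * sl2_F + sl2_F * sl2_E + (1/2) *\<^sub>C (sl2_H * sl2_H)"

definition sl2_Delta :: "usl2 \<Rightarrow> (usl2, usl2) tensor" where
  "sl2_Delta = presented_lift (\<lambda>X. gen X \<otimes>\<^sub>t 1 + 1 \<otimes>\<^sub>t gen X)"

text \<open>The module \<open>L\<^sub>n\<close> has the carrier \<open>coord_space n\<close>; the operators are extended by zero on the
  remaining basis vectors of the ambient space. For \<open>i = 0\<close> and \<open>i = n\<close> the coefficients give
  \<open>E v\<^sub>0 = 0\<close> and \<open>F v\<^sub>n = 0\<close>.\<close>

primrec sl2_L_gen :: "nat \<Rightarrow> sl2_gen \<Rightarrow> (nat \<Rightarrow>\<^sub>0 complex) endo" where
  "sl2_L_gen n Egen = linear_endo (\<lambda>i. if i \<le> n then of_nat i *\<^sub>C basis_vec (i - 1) else 0)"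
| "sl2_L_gen n Fgen =
     linear_endo (\<lambda>i. if i \<le> n then (of_nat n - of_nat i) *\<^sub>C basis_vec (i + 1) else 0)"
| "sl2_L_gen n Hgen =
     linear_endo (\<lambda>i. if i \<le> n then (of_nat n - 2 * of_nat i) *\<^sub>C basis_vec i else 0)"

definition sl2_L :: "nat \<Rightarrow> usl2 \<Rightarrow> (nat \<Rightarrow>\<^sub>0 complex) endo" where
  "sl2_L n = presented_lift (sl2_L_gen n)"

definition LL_space :: "nat \<Rightarrow> nat \<Rightarrow> (nat \<Rightarrow>\<^sub>0 complex, nat \<Rightarrow>\<^sub>0 complex) tensor set" where
  "LL_space m n = tensor_space (coord_space m) (coord_space n)"

definition LL_action :: "nat \<Rightarrow> nat \<Rightarrow> (usl2, usl2) tensor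
    \<Rightarrow> (nat \<Rightarrow>\<^sub>0 complex, nat \<Rightarrow>\<^sub>0 complex) tensor
    \<Rightarrow> (nat \<Rightarrow>\<^sub>0 complex, nat \<Rightarrow>\<^sub>0 complex) tensor" where
  "LL_action m n x = endo_apply (tensor_action (sl2_L m) (sl2_L n) x)"

definition weight_space :: "'v::complex_vector set \<Rightarrow> ((usl2, usl2) tensor \<Rightarrow> 'v \<Rightarrow> 'v)
    \<Rightarrow> complex \<Rightarrow> 'v set" where
  "weight_space V act \<theta> = {v \<in> V. act (sl2_Delta sl2_H) v = \<theta> *\<^sub>C v}"

section \<open>The universal Hahn algebra\<close>

datatype hahn_gen = Agen | Bgen | Cgen

definition hahn_alpha :: "hahn_gen alg_expr" where
  "hahn_alpha = Add (Add (Comm (Gen Cgen) (Gen Agen)) (Scale 2 (Mul (Gen Agen) (Gen Agen)))) (Gen Bgen)"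

definition hahn_beta :: "hahn_gen alg_expr" where
  "hahn_beta = Add (Add (Comm (Gen Bgen) (Gen Cgen)) (Scale 4 (Mul (Gen Bgen) (Gen Agen))))
     (Scale 2 (Gen Cgen))"

instantiation hahn_gen :: presentation
begin
definition relations_hahn_gen :: "(hahn_gen alg_expr \<times> hahn_gen alg_expr) set" where
  "relations_hahn_gen =
     {(Comm (Gen Agen) (Gen Bgen), Gen Cgen)}
   \<union> {(Mul hahn_alpha x, Mul x hahn_alpha) | x. True}
   \<union> {(Mul hahn_beta x, Mul x hahn_beta) | x. True}"
instance ..
end

type_synonym hahn = "hahn_gen presented"

primrec hahn_natural_gen :: "hahn_gen \<Rightarrow> (usl2, usl2) tensor" where
  "hahn_natural_gen Agen = (1/4) *\<^sub>C (sl2_H \<otimes>\<^sub>t 1 - 1 \<otimes>\<^sub>t sl2_H)"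
| "hahn_natural_gen Bgen = (1/2) *\<^sub>C sl2_Delta sl2_Casimir"
| "hahn_natural_gen Cgen = sl2_E \<otimes>\<^sub>t sl2_F - sl2_F \<otimes>\<^sub>t sl2_E"

definition hahn_natural :: "hahn \<Rightarrow> (usl2, usl2) tensor" where
  "hahn_natural = presented_lift hahn_natural_gen"

text \<open>The module \<open>V\<^sub>d(a, b)\<close> has the carrier \<open>coord_space d\<close>; as before, the operators vanish on the
  remaining basis vectors. The generator \<open>C\<close> acts as \<open>[A, B]\<close>, as it must.\<close>

definition hahn_theta :: "complex \<Rightarrow> nat \<Rightarrow> nat \<Rightarrow> complex" where
  "hahn_theta a d i = (a + of_nat d) / 2 - of_nat i"

definition hahn_theta_star :: "complex \<Rightarrow> nat \<Rightarrow> complex" where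
  "hahn_theta_star b i = (b + of_nat i) * (b + of_nat i + 1)"

definition hahn_phi :: "complex \<Rightarrow> complex \<Rightarrow> nat \<Rightarrow> nat \<Rightarrow> complex" where
  "hahn_phi a b d i = of_nat i * (of_nat i - of_nat d - 1) * (a - b - of_nat i)"

definition hahn_V_A :: "nat \<Rightarrow> complex \<Rightarrow> complex \<Rightarrow> (nat \<Rightarrow>\<^sub>0 complex) endo" where
  "hahn_V_A d a b = linear_endo (\<lambda>i. if i \<le> d
     then hahn_theta a d i *\<^sub>C basis_vec i
       + (if 1 \<le> i then hahn_phi a b d i *\<^sub>C basis_vec (i - 1) else 0)
     else 0)"

definition hahn_V_B :: "nat \<Rightarrow> complex \<Rightarrow> (nat \<Rightarrow>\<^sub>0 complex) endo" where
  "hahn_V_B d b = linear_endo (\<lambda>i. if i \<le> d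
     then hahn_theta_star b i *\<^sub>C basis_vec i + (if i < d then basis_vec (i + 1) else 0)
     else 0)"

primrec hahn_V_gen :: "nat \<Rightarrow> complex \<Rightarrow> complex \<Rightarrow> hahn_gen \<Rightarrow> (nat \<Rightarrow>\<^sub>0 complex) endo" where
  "hahn_V_gen d a b Agen = hahn_V_A d a b"
| "hahn_V_gen d a b Bgen = hahn_V_B d b"
| "hahn_V_gen d a b Cgen = commutator (hahn_V_A d a b) (hahn_V_B d b)"

definition hahn_V_action ::
  "nat \<Rightarrow> complex \<Rightarrow> complex \<Rightarrow> hahn \<Rightarrow> (nat \<Rightarrow>\<^sub>0 complex) \<Rightarrow> (nat \<Rightarrow>\<^sub>0 complex)" where
  "hahn_V_action d a b x = endo_apply (presented_lift (hahn_V_gen d a b) x)"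

end

theory Submission
  imports Defs
begin

text \<open>In \<open>U(sl\<^sub>2) \<otimes> U(sl\<^sub>2)\<close> one finds \<open>\<alpha> = (\<Lambda> \<otimes> 1 + 1 \<otimes> \<Lambda>)/2 + \<Delta>(H)\<^sup>2/8\<close> and
  \<open>\<beta> = (\<Lambda> \<otimes> 1 - 1 \<otimes> \<Lambda>) \<Delta>(H)/2\<close>, and \<open>\<Delta>(H)\<close> commutes with the images of \<open>A, B, C\<close>; hence \<open>\<natural>\<close>
  is well defined. The weight space has the basis \<open>u\<^sub>i = v\<^sub>i\<^sub>0\<^sub>+\<^sub>i \<otimes> v\<^sub>j\<^sub>0\<^sub>-\<^sub>i\<close> for \<open>0 \<le> i \<le> d\<close>, where
  \<open>j\<^sub>0 = min n l\<close> and \<open>i\<^sub>0 = l - j\<^sub>0\<close>. There \<open>A u\<^sub>i = \<theta>\<^sub>i u\<^sub>i\<close> and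
  \<open>B u\<^sub>i = (\<theta>\<^sup>*\<^sub>0 - p\<^sub>i - q\<^sub>i) u\<^sub>i + p\<^sub>i u\<^sub>i\<^sub>+\<^sub>1 + q\<^sub>i u\<^sub>i\<^sub>-\<^sub>1\<close> with \<open>p\<^sub>i = (d - i)(e - i)\<close> and \<open>q\<^sub>i = i(i + h)\<close>.
  The module \<open>V\<^sub>d(a, b)\<close> has a basis with the same action, given by binomial coefficients in terms of
  the defining one, and binomial inversion gives the isomorphism. The module is irreducible because
  \<open>A\<close> has distinct eigenvalues and the off-diagonal entries \<open>p\<^sub>i\<close>, \<open>q\<^sub>i\<close> of \<open>B\<close> inside the range do
  not vanish.\<close>

section \<open>Algebras given by presentations\<close>

lemma algebra_homD:
  assumes "algebra_hom f"
  shows "clinear f" "f (x * y) = f x * f y" "f 1 = 1" "f (x + y) = f x + f y"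
    "f (c *\<^sub>C x) = c *\<^sub>C f x" "f (x - y) = f x - f y" "f 0 = 0"
  using assms clinear_add[of f] clinear_scale[of f] clinear_diff[of f] clinear_zero[of f]
  by (auto simp: algebra_hom_def)

lemma algebra_hom_compose:
  assumes f: "algebra_hom f" and g: "algebra_hom g"
  shows "algebra_hom (\<lambda>x. f (g x))"
  unfolding algebra_hom_def
  by (auto intro: clinearI simp: algebra_homD[OF f] algebra_homD[OF g])

lemma abs_presented_ex: "\<exists>e. x = abs_presented e"
  by (metis Quotient3_abs_rep Quotient3_presented)

text \<open>A homomorphism is determined by its values on generators. Only constants need care:
  \<open>abs_presented (Const c)\<close> must be recognised as \<open>c\<close> times the
  unit.\<close>

lemma algebra_hom_abs_presented:
  assumes R: "algebra_hom R"
  shows "R (abs_presented e) = alg_eval (\<lambda>g. R (gen g)) e"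
proof (induction e)
  case (Const c)
  have "abs_presented (Const c) = c *\<^sub>C (1 :: 'a presented)"
    unfolding one_presented.abs_eq scaleC_presented.abs_eq presented.abs_eq_iff
    using cong_Const_mult[of c 1] by simp
  then show ?case by (simp add: algebra_homD[OF R])
qed (simp_all add: gen.abs_eq algebra_homD[OF R] flip: plus_presented.abs_eq times_presented.abs_eq)

lemma satisfies_relations_algebra_hom:
  assumes R: "algebra_hom R"
  shows "satisfies_relations (\<lambda>g. R (gen g))"
  unfolding satisfies_relations_def
proof clarify
  fix x y :: "'a alg_expr"
  assume "(x, y) \<in> relations"
  then have "abs_presented x = abs_presented y"
    by (simp add: presented.abs_eq_iff cong_relation)
  then show "alg_eval (\<lambda>g. R (gen g)) x = alg_eval (\<lambda>g. R (gen g)) y"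
    by (simp flip: algebra_hom_abs_presented[OF R])
qed

text \<open>The centraliser of \<open>z\<close> is a subalgebra. Hence the centrality relations for
  \<alpha> and \<beta>, which range over all expressions, have to be checked on generators
  only.\<close>

lemma alg_eval_commute:
  assumes "\<And>g. z * f g = f g * z"
  shows "z * alg_eval f e = alg_eval f e * z"
proof (induction e)
  case (Mul x y)
  then show ?case by (simp add: mult.assoc) (metis mult.assoc)
qed (auto simp: assms algebra_simps)

lemma satisfies_relations_hahnI:
  fixes f :: "hahn_gen \<Rightarrow> 'b::complex_algebra"
  assumes "f Agen * f Bgen - f Bgen * f Agen = f Cgen"
    and "\<And>g. alg_eval f hahn_alpha * f g = f g * alg_eval f hahn_alpha"
    and "\<And>g. alg_eval f hahn_beta * f g = f g * alg_eval f hahn_beta"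
  shows "satisfies_relations f"
  unfolding satisfies_relations_def relations_hahn_gen_def
  using assms(1) alg_eval_commute[of "alg_eval f hahn_alpha" f, OF assms(2)]
    alg_eval_commute[of "alg_eval f hahn_beta" f, OF assms(3)]
  by auto

text \<open>Lifts a rewrite rule for \<open>u * v\<close> to right-nested products, so that
  commutation rules keep firing inside words normalised by associativity.\<close>

lemma mult_left_assocI: "u * v = w \<Longrightarrow> u * (v * t) = w * (t :: 'a::semigroup_mult)"
  by (simp add: mult.assoc[symmetric])

lemma commutes_add: "x * z = z * x \<Longrightarrow> y * z = z * y \<Longrightarrow> (x + y) * z = z * (x + y)"
  for x y z :: "'a::ring"
  by (simp add: algebra_simps)

lemma commutes_diff: "x * z = z * x \<Longrightarrow> y * z = z * y \<Longrightarrow> (x - y) * z = z * (x - y)"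
  for x y z :: "'a::ring"
  by (simp add: algebra_simps)

lemma commutes_mult: "x * z = z * x \<Longrightarrow> y * z = z * y \<Longrightarrow> (x * y) * z = z * (x * y)"
  for x y z :: "'a::semigroup_mult"
  by (metis mult.assoc)

lemma commutes_scaleC: "x * z = z * x \<Longrightarrow> (c *\<^sub>C x) * z = z * (c *\<^sub>C x)"
  for x z :: "'a::complex_algebra"
  by simp

lemmas commutes_closed = commutes_add commutes_diff commutes_mult commutes_scaleC

section \<open>The homomorphism \<open>\<natural>\<close>\<close>

lemma half_double: "(1/2) *\<^sub>C x + (1/2) *\<^sub>C x = (x :: 'a::complex_vector)"
  by (simp flip: scaleC_add_left)

lemma scaleC_2: "2 *\<^sub>C x = x + (x :: 'a::complex_vector)"
  using scaleC_add_left[of 1 1 x] by simp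

text \<open>Eliminating \<open>f * e\<close> turns the halved Casimir into
  \<open>e * f - k + k * k\<close>. Centrality is then a normal-form computation with
  \<open>e\<close> before \<open>f\<close> before \<open>k\<close>.\<close>

lemma sl2_half_relations:
  fixes e f h :: "'a::complex_algebra"
  assumes he: "h * e - e * h = 2 *\<^sub>C e" and hf: "h * f - f * h = (- 2) *\<^sub>C f"
    and ef: "e * f - f * e = h"
  defines "k \<equiv> (1/2) *\<^sub>C h"
    and "L \<equiv> (1/2) *\<^sub>C (e * f + f * e + (1/2) *\<^sub>C (h * h))"
  shows "k * e = e * k + e" "k * f = f * k - f" "e * f = L - k * k + k" "f * e = L - k * k - k"
    "e * L = L * e" "f * L = L * f" "k * L = L * k"
proof -
  have "(1/2) *\<^sub>C (h * e - e * h) = e" "(1/2) *\<^sub>C (h * f - f * h) = - f"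
    unfolding he hf by simp_all
  then show ke: "k * e = e * k + e" and kf: "k * f = f * k - f"
    unfolding k_def
    by (simp_all add: complex_vector.scale_right_diff_distrib algebra_simps)
  have h: "h = k + k" unfolding k_def by (simp add: half_double)
  have fe: "f * e = e * f - k - k" using ef h by (simp add: algebra_simps)
  have L: "L = e * f - k + k * k"
  proof -
    have "L = (1/2) *\<^sub>C (e * f + f * e) + k * k"
      unfolding L_def k_def by (simp add: scaleC_add_right)
    also have "e * f + f * e = (e * f - k) + (e * f - k)" by (simp add: fe)
    finally show ?thesis by (simp add: scaleC_add_right half_double)
  qed
  show "e * f = L - k * k + k" "f * e = L - k * k - k" by (simp_all add: L fe)
  note rules = ke kf fe ke[THEN mult_left_assocI] kf[THEN mult_left_assocI] fe[THEN mult_left_assocI]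
  show "e * L = L * e" "f * L = L * f" "k * L = L * k"
    unfolding L by (simp_all add: algebra_simps rules)
qed

text \<open>Here \<open>k, k'\<close> are the halved \<open>H\<close>, \<open>L, L'\<close> the halved Casimir elements, \<open>X = E \<otimes> F\<close> and \<open>Y = F \<otimes> E\<close>;
  the halving makes all coefficients integral.\<close>

lemma hahn_beta_ring_identity:
  fixes X Y k k' L L' B :: "'a::ring"
  assumes kX: "k * X = X * k + X" "k' * X = X * k' - X"
    and kY: "k * Y = Y * k - Y" "k' * Y = Y * k' + Y"
    and XY: "X * Y = (L - k * k + k) * (L' - k' * k' - k')"
    and YX: "Y * X = (L - k * k - k) * (L' - k' * k' + k')"
    and kk: "k' * k = k * k'"
    and L: "X * L = L * X" "Y * L = L * Y" "k * L = L * k" "k' * L = L * k'"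
    and L': "X * L' = L' * X" "Y * L' = L' * Y" "k * L' = L' * k" "k' * L' = L' * k'" "L' * L = L * L'"
    and B: "B = L + L' + X + Y + k * k' + k * k'"
  shows "(B * (X - Y) - (X - Y) * B) + (B * (k - k') + B * (k - k')) + ((X - Y) + (X - Y))
    = (L - L') * (k + k') + (L - L') * (k + k')"
proof -
  note rules = kX kY kk L L' kX[THEN mult_left_assocI] kY[THEN mult_left_assocI] kk[THEN mult_left_assocI] L[THEN mult_left_assocI] L'[THEN mult_left_assocI]
  show ?thesis
    unfolding B
    by (simp add: algebra_simps XY YX rules)
qed

text \<open>Stated in any algebra, so that tensors enter only through the commutation of the two
  triples. \<alpha> and \<beta> turn out to be polynomials in \<open>L\<close>, \<open>L'\<close>
  and \<open>k + k'\<close>, and these commute with the images of \<open>A\<close>,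
  \<open>B\<close>, \<open>C\<close>.\<close>

lemma hahn_relations_of_sl2_pair:
  fixes e f h e' f' h' :: "'a::complex_algebra" and \<phi> :: "hahn_gen \<Rightarrow> 'a"
  assumes rel: "h * e - e * h = 2 *\<^sub>C e" "h * f - f * h = (- 2) *\<^sub>C f" "e * f - f * e = h"
    and rel': "h' * e' - e' * h' = 2 *\<^sub>C e'" "h' * f' - f' * h' = (- 2) *\<^sub>C f'"
      "e' * f' - f' * e' = h'"
    and comm: "e' * e = e * e'" "e' * f = f * e'" "e' * h = h * e'"
      "f' * e = e * f'" "f' * f = f * f'" "f' * h = h * f'"
      "h' * e = e * h'" "h' * f = f * h'" "h' * h = h * h'"
    and A: "\<phi> Agen = (1/4) *\<^sub>C (h - h')"
    and B: "\<phi> Bgen = (1/2) *\<^sub>C ((e + e') * (f + f') + (f + f') * (e + e')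
      + (1/2) *\<^sub>C ((h + h') * (h + h')))"
    and C: "\<phi> Cgen = e * f' - f * e'"
  shows "satisfies_relations \<phi>"
proof -
  define k k' where "k = (1/2) *\<^sub>C h" and "k' = (1/2) *\<^sub>C h'"
  define L where "L = (1/2) *\<^sub>C (e * f + f * e + (1/2) *\<^sub>C (h * h))"
  define L' where "L' = (1/2) *\<^sub>C (e' * f' + f' * e' + (1/2) *\<^sub>C (h' * h'))"
  define X Y where "X = e * f'" and "Y = f * e'"
  note sl2 = sl2_half_relations[OF rel, folded k_def L_def]
  note sl2' = sl2_half_relations[OF rel', folded k'_def L'_def]
  have comm_k: "e' * k = k * e'" "f' * k = k * f'" "h' * k = k * h'"
    "k' * e = e * k'" "k' * f = f * k'" "k' * h = h * k'" "k' * k = k * k'"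
    unfolding k_def k'_def by (simp_all add: comm)
  note comm_all = comm comm_k
  have comm_L: "L * e' = e' * L" "L * f' = f' * L" "L * h' = h' * L" "L * k' = k' * L"
    unfolding L_def by (intro commutes_closed; simp add: comm_all)+
  have comm_L': "L' * e = e * L'" "L' * f = f * L'" "L' * k = k * L'" "L' * L = L * L'"
    unfolding L'_def by (intro commutes_closed; simp add: comm_all comm_L)+
  have kX: "k * X = X * k + X" "k' * X = X * k' - X"
    unfolding X_def
    by (simp_all add: algebra_simps sl2(1) sl2'(2) comm_all
        sl2(1)[THEN mult_left_assocI] comm_all[THEN mult_left_assocI])
  have kY: "k * Y = Y * k - Y" "k' * Y = Y * k' + Y"
    unfolding Y_def
    by (simp_all add: algebra_simps sl2(2) sl2'(1) comm_all
        sl2(2)[THEN mult_left_assocI] comm_all[THEN mult_left_assocI])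
  \<comment> \<open>Sorting the commuting factors leaves one product per triple, and the Casimir
    formulas then eliminate \<open>X\<close> and \<open>Y\<close> from it.\<close>
  have "X * Y = (e * f) * (f' * e')" "Y * X = (f * e) * (e' * f')"
    unfolding X_def Y_def
    by (simp_all add: mult.assoc comm_all comm_all[THEN mult_left_assocI])
  then have XY: "X * Y = (L - k * k + k) * (L' - k' * k' - k')"
    and YX: "Y * X = (L - k * k - k) * (L' - k' * k' + k')"
    by (simp_all only: sl2(3,4) sl2'(3,4))
  have LX: "L * X = X * L" "L * Y = Y * L" "L * k = k * L"
    unfolding X_def Y_def
    using comm_L sl2(5-7) by (metis mult.assoc)+
  have LX': "L' * X = X * L'" "L' * Y = Y * L'" "L' * k' = k' * L'"
    unfolding X_def Y_def
    using comm_L' sl2'(5-7) by (metis mult.assoc)+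
  define B where "B = L + L' + X + Y + k * k' + k * k'"
  have h: "h = k + k" "h' = k' + k'" unfolding k_def k'_def by (simp_all add: half_double)
  have \<phi>A: "\<phi> Agen = (1/2) *\<^sub>C (k - k')"
    unfolding A k_def k'_def by (simp add: complex_vector.scale_right_diff_distrib)
  have \<phi>C: "\<phi> Cgen = X - Y" unfolding C X_def Y_def ..
  have \<phi>B: "\<phi> Bgen = B"
  proof -
    have "\<phi> Bgen = L + L' + (1/2) *\<^sub>C ((X + Y + k * k') + (X + Y + k * k') + (k * k' + k * k'))"
      unfolding B L_def L'_def X_def Y_def h
      by (simp add: algebra_simps scaleC_add_right comm_all half_double)
    then show ?thesis
      unfolding B_def scaleC_add_right half_double
      by (simp add: algebra_simps) (simp add: half_double flip: add.assoc)
  qed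
  have AB: "\<phi> Agen * \<phi> Bgen - \<phi> Bgen * \<phi> Agen = \<phi> Cgen"
  proof -
    have "(k - k') * B - B * (k - k') = (X - Y) + (X - Y)"
      unfolding B_def
      by (simp add: algebra_simps kX kY comm_all LX LX' comm_L comm_L'
          comm_all[THEN mult_left_assocI])
    then have "(1/2) *\<^sub>C ((k - k') * B - B * (k - k')) = X - Y"
      by (simp add: scaleC_add_right half_double)
    then show ?thesis
      by (simp add: \<phi>A \<phi>B \<phi>C flip: complex_vector.scale_right_diff_distrib)
  qed
  have alpha: "alg_eval \<phi> hahn_alpha = L + L' + (1/2) *\<^sub>C ((k + k') * (k + k'))"
  proof -
    let ?D = "k - k'" and ?C = "X - Y"
    have "alg_eval \<phi> hahn_alpha = (1/2) *\<^sub>C ((?C * ?D - ?D * ?C) + ?D * ?D + (B + B))"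
      unfolding hahn_alpha_def
      by (simp add: \<phi>A \<phi>B \<phi>C scaleC_add_right half_double flip: complex_vector.scale_right_diff_distrib)
    also have "(?C * ?D - ?D * ?C) + ?D * ?D + (B + B) = (L + L') + (L + L') + (k + k') * (k + k')"
      unfolding B_def by (simp add: algebra_simps kX kY comm_all)
    finally show ?thesis
      by (simp only: scaleC_add_right[of _ "(L + L') + (L + L')"]
          scaleC_add_right[of _ "L + L'" "L + L'"] half_double)
  qed
  have beta: "alg_eval \<phi> hahn_beta = (L - L') * (k + k') + (L - L') * (k + k')"
  proof -
    \<comment> \<open>The scalars are spelled out as repeated sums to match an identity in a ring
      without scalars.\<close>
    have "alg_eval \<phi> hahn_beta = (B * (X - Y) - (X - Y) * B) + (B * (k - k') + B * (k - k')) + ((X - Y) + (X - Y))"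
      unfolding hahn_beta_def by (simp add: \<phi>A \<phi>B \<phi>C) (simp add: scaleC_2)
    also have "\<dots> = (L - L') * (k + k') + (L - L') * (k + k')"
      by (rule hahn_beta_ring_identity[OF kX kY XY YX _ _ _ _ _ _ _ _ _ _ B_def])
        (simp_all add: comm_all LX LX' comm_L comm_L')
    finally show ?thesis .
  qed
  \<comment> \<open>\<open>K\<close> is half of \<Delta>(H). Passing \<open>X\<close> shifts
    \<open>k\<close> and \<open>k'\<close> by opposite units, so their sum commutes with it;
    likewise for \<open>Y\<close>.\<close>
  define K where "K = k + k'"
  have KX: "X * K = K * X" "Y * K = K * Y" "k * K = K * k" "k' * K = K * k'" "L * K = K * L" "L' * K = K * L'"
    unfolding K_def by (simp_all add: algebra_simps kX kY comm_all LX LX' comm_L comm_L')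
  have K: "K * \<phi> g = \<phi> g * K" for g
    by (cases g; simp only: \<phi>A \<phi>B \<phi>C B_def; rule sym; intro commutes_closed; simp add: KX)
  have LL: "L * \<phi> g = \<phi> g * L" "L' * \<phi> g = \<phi> g * L'" for g
    by (cases g; simp only: \<phi>A \<phi>B \<phi>C B_def; rule sym; intro commutes_closed;
      simp add: LX LX' comm_L comm_L')+
  show ?thesis
    by (rule satisfies_relations_hahnI[OF AB]; unfold alpha beta K_def[symmetric]; intro commutes_closed K LL)
qed

section \<open>The homomorphisms \<Delta> and natural on U(sl_2)\<close>

lemma sl2_relations:
  "sl2_H * sl2_E - sl2_E * sl2_H = 2 *\<^sub>C sl2_E"
  "sl2_H * sl2_F - sl2_F * sl2_H = (- 2) *\<^sub>C sl2_F"
  "sl2_E * sl2_F - sl2_F * sl2_E = sl2_H"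
proof -
  have "algebra_hom (\<lambda>x :: usl2. x)"
    by (simp add: algebra_hom_def clinearI)
  from satisfies_relations_algebra_hom[OF this]
  show "sl2_H * sl2_E - sl2_E * sl2_H = 2 *\<^sub>C sl2_E"
    "sl2_H * sl2_F - sl2_F * sl2_H = (- 2) *\<^sub>C sl2_F"
    "sl2_E * sl2_F - sl2_F * sl2_E = sl2_H"
    by (simp_all add: satisfies_relations_def relations_sl2_gen_def sl2_E_def sl2_F_def sl2_H_def)
qed

lemma satisfies_relations_sl2I:
  fixes \<phi> :: "sl2_gen \<Rightarrow> 'b::complex_algebra"
  assumes "\<phi> Hgen * \<phi> Egen - \<phi> Egen * \<phi> Hgen = 2 *\<^sub>C \<phi> Egen"
    and "\<phi> Hgen * \<phi> Fgen - \<phi> Fgen * \<phi> Hgen = (- 2) *\<^sub>C \<phi> Fgen"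
    and "\<phi> Egen * \<phi> Fgen - \<phi> Fgen * \<phi> Egen = \<phi> Hgen"
  shows "satisfies_relations \<phi>"
  using assms by (simp add: satisfies_relations_def relations_sl2_gen_def)

lemma tensor_pure_zero [simp]: "0 \<otimes>\<^sub>t z = 0" "w \<otimes>\<^sub>t 0 = 0"
  using tensor_pure_simps(2)[of 0 0 z] tensor_pure_simps(4)[of w 0 0] by simp_all

lemma algebra_hom_tensor_inclusion:
  "algebra_hom (\<lambda>x. x \<otimes>\<^sub>t 1)" "algebra_hom (\<lambda>y. 1 \<otimes>\<^sub>t y)"
  by (auto simp: algebra_hom_def one_tensor_def tensor_pure_mult tensor_pure_simps intro!: clinearI)

lemma sl2_relations_hom:
  assumes i: "algebra_hom i"
  shows "i sl2_H * i sl2_E - i sl2_E * i sl2_H = 2 *\<^sub>C i sl2_E"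
    "i sl2_H * i sl2_F - i sl2_F * i sl2_H = (- 2) *\<^sub>C i sl2_F"
    "i sl2_E * i sl2_F - i sl2_F * i sl2_E = i sl2_H"
  by (simp_all only: sl2_relations flip: algebra_homD[OF i])

text \<open>The two inclusions into the tensor product commute, so the mixed terms of each
  commutator cancel and the relations hold factor by factor.\<close>

lemma algebra_hom_sl2_Delta: "algebra_hom sl2_Delta"
  and sl2_Delta_gen: "sl2_Delta (gen X) = gen X \<otimes>\<^sub>t 1 + 1 \<otimes>\<^sub>t gen X"
proof -
  let ?i = "\<lambda>x. x \<otimes>\<^sub>t 1 :: (usl2, usl2) tensor" and ?j = "\<lambda>x. 1 \<otimes>\<^sub>t x :: (usl2, usl2) tensor"
  note rel = sl2_relations_hom[OF algebra_hom_tensor_inclusion(1)]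
    sl2_relations_hom[OF algebra_hom_tensor_inclusion(2)]
  have ij: "?i x * ?j y = ?j y * ?i x" for x y
    by (simp add: tensor_pure_mult)
  have add: "(?i x + ?j x) * (?i y + ?j y) - (?i y + ?j y) * (?i x + ?j x)
    = (?i x * ?i y - ?i y * ?i x) + (?j x * ?j y - ?j y * ?j x)" for x y
    using ij[of x y] ij[of y x] by (simp add: algebra_simps)
  have "satisfies_relations (\<lambda>X. ?i (gen X) + ?j (gen X))"
    by (rule satisfies_relations_sl2I;
        simp only: add flip: sl2_E_def sl2_F_def sl2_H_def)
      (simp_all only: rel scaleC_add_right)
  then show "algebra_hom sl2_Delta" "sl2_Delta (gen X) = gen X \<otimes>\<^sub>t 1 + 1 \<otimes>\<^sub>t gen X"
    unfolding sl2_Delta_def by (simp_all add: algebra_hom_presented_lift presented_lift_gen)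
qed

lemma sl2_Delta_simps:
  "sl2_Delta sl2_E = sl2_E \<otimes>\<^sub>t 1 + 1 \<otimes>\<^sub>t sl2_E"
  "sl2_Delta sl2_F = sl2_F \<otimes>\<^sub>t 1 + 1 \<otimes>\<^sub>t sl2_F"
  "sl2_Delta sl2_H = sl2_H \<otimes>\<^sub>t 1 + 1 \<otimes>\<^sub>t sl2_H"
  by (simp_all add: sl2_E_def sl2_F_def sl2_H_def sl2_Delta_gen)

lemma sl2_Delta_Casimir:
  "sl2_Delta sl2_Casimir = (let e = sl2_Delta sl2_E; f = sl2_Delta sl2_F; h = sl2_Delta sl2_H
    in e * f + f * e + (1/2) *\<^sub>C (h * h))"
  unfolding sl2_Casimir_def Let_def by (simp add: algebra_homD[OF algebra_hom_sl2_Delta])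

lemma satisfies_relations_hahn_natural: "satisfies_relations hahn_natural_gen"
  by (rule hahn_relations_of_sl2_pair[OF sl2_relations_hom[OF algebra_hom_tensor_inclusion(1)]
        sl2_relations_hom[OF algebra_hom_tensor_inclusion(2)]])
    (simp_all add: sl2_Delta_Casimir sl2_Delta_simps Let_def tensor_pure_mult)

lemma algebra_hom_hahn_natural: "algebra_hom hahn_natural"
  unfolding hahn_natural_def by (rule algebra_hom_presented_lift[OF satisfies_relations_hahn_natural])

lemma hahn_natural_gen: "hahn_natural (gen g) = hahn_natural_gen g"
  unfolding hahn_natural_def by (rule presented_lift_gen[OF satisfies_relations_hahn_natural])

section \<open>Tensor products of representations\<close>

lemma clinear_endo_apply: "clinear (endo_apply f)"
  using endo_apply by blast

lemmas endo_apply_linear =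
  clinear_add[OF clinear_endo_apply] clinear_scale[OF clinear_endo_apply]
  clinear_diff[OF clinear_endo_apply] clinear_zero[OF clinear_endo_apply]

lemmas endo_apply_simps =
  zero_endo.rep_eq one_endo.rep_eq plus_endo.rep_eq minus_endo.rep_eq times_endo.rep_eq
  scaleC_endo.rep_eq uminus_endo.rep_eq

lemma endo_eqI: "(\<And>v. endo_apply f v = endo_apply g v) \<Longrightarrow> f = g"
  by (simp add: endo_apply_inject[symmetric] fun_eq_iff)

lemma endo_free_eqI:
  fixes f g :: "('i \<Rightarrow>\<^sub>0 complex) endo"
  assumes "\<And>i. endo_apply f (basis_vec i) = endo_apply g (basis_vec i)"
  shows "f = g"
proof (rule endo_eqI)
  fix p
  show "endo_apply f p = endo_apply g p"
    by (induction p rule: free_space_induct) (simp_all add: assms endo_apply_linear)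
qed

lemma endo_tensor_eqI:
  fixes f g :: "('v::complex_vector, 'w::complex_vector) tensor endo"
  assumes "\<And>v w. endo_apply f (v \<otimes>\<^sub>t w) = endo_apply g (v \<otimes>\<^sub>t w)"
  shows "f = g"
proof (rule endo_eqI)
  fix t
  show "endo_apply f t = endo_apply g t"
    by (induction t rule: tensor_induct) (simp_all add: assms endo_apply_linear)
qed

lemma endo_tensor_pure [simp]:
  "endo_apply (endo_tensor f g) (v \<otimes>\<^sub>t w) = endo_apply f v \<otimes>\<^sub>t endo_apply g w"
proof -
  have "cbilinear (\<lambda>v w. endo_apply f v \<otimes>\<^sub>t endo_apply g w)"
    by (rule cbilinearI) (simp_all add: endo_apply_linear tensor_pure_simps)
  then show ?thesis
    by (simp add: endo_tensor_def Abs_endo_inverse clinear_tensor_lift tensor_lift_pure)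
qed

lemma cbilinear_tensor_action:
  assumes "algebra_hom \<rho>" "algebra_hom \<sigma>"
  shows "cbilinear (\<lambda>x y. endo_tensor (\<rho> x) (\<sigma> y))"
  by (rule cbilinearI; rule endo_tensor_eqI)
    (simp_all add: algebra_homD[OF assms(1)] algebra_homD[OF assms(2)] endo_apply_simps tensor_pure_simps)

lemma tensor_action_pure:
  assumes "algebra_hom \<rho>" "algebra_hom \<sigma>"
  shows "tensor_action \<rho> \<sigma> (x \<otimes>\<^sub>t y) = endo_tensor (\<rho> x) (\<sigma> y)"
  unfolding tensor_action_def by (rule tensor_lift_pure[OF cbilinear_tensor_action[OF assms]])

lemma algebra_hom_tensor_action:
  assumes "algebra_hom \<rho>" "algebra_hom \<sigma>"
  shows "algebra_hom (tensor_action \<rho> \<sigma>)"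
proof -
  have lin: "clinear (tensor_action \<rho> \<sigma>)"
    unfolding tensor_action_def by (rule clinear_tensor_lift[OF cbilinear_tensor_action[OF assms]])
  note pure = tensor_action_pure[OF assms]
  have "tensor_action \<rho> \<sigma> (s * t) = tensor_action \<rho> \<sigma> s * tensor_action \<rho> \<sigma> t" for s t
  proof (induction s rule: tensor_induct)
    case (pure x y)
    show ?case
    proof (induction t rule: tensor_induct)
      case (pure x' y')
      show ?case
        by (rule endo_tensor_eqI)
          (simp add: tensor_pure_mult \<open>\<And>x y. tensor_action \<rho> \<sigma> (x \<otimes>\<^sub>t y) = _ x y\<close>
            algebra_homD[OF assms(1)] algebra_homD[OF assms(2)] endo_apply_simps)
    qed (simp_all add: distrib_left clinear_add[OF lin] clinear_scale[OF lin])
  qed (simp_all add: distrib_right clinear_add[OF lin] clinear_scale[OF lin])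
  moreover have "tensor_action \<rho> \<sigma> 1 = 1"
    unfolding one_tensor_def pure
    by (rule endo_tensor_eqI) (simp add: algebra_homD[OF assms(1)] algebra_homD[OF assms(2)] endo_apply_simps)
  ultimately show ?thesis using lin by (simp add: algebra_hom_def)
qed

section \<open>The modules \<open>L\<^sub>n\<close>\<close>

(* single_one would rewrite the basis vector of index 0 to 1. *)
declare single_one [simp del]

lemma sl2_L_gen_basis:
  "endo_apply (sl2_L_gen n Egen) (basis_vec i) = (if i \<le> n then of_nat i *\<^sub>C basis_vec (i - 1) else 0)"
  "endo_apply (sl2_L_gen n Fgen) (basis_vec i)
    = (if i \<le> n then (of_nat n - of_nat i) *\<^sub>C basis_vec (i + 1) else 0)"
  "endo_apply (sl2_L_gen n Hgen) (basis_vec i)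
    = (if i \<le> n then (of_nat n - 2 * of_nat i) *\<^sub>C basis_vec i else 0)"
  by simp_all

lemma satisfies_relations_sl2_L: "satisfies_relations (sl2_L_gen n)"
proof (rule satisfies_relations_sl2I; rule endo_free_eqI)
  fix i
  note simps = endo_apply_simps sl2_L_gen_basis endo_apply_linear
    complex_vector.scale_left_diff_distrib[symmetric] complex_vector.scale_minus_left[symmetric]
  \<comment> \<open>Beyond \<open>n\<close> all operators vanish. The ends 0 and \<open>n\<close>
    are split off because there \<open>i - 1\<close> truncates or \<open>i + 1\<close> leaves the
    range, with coefficient zero.\<close>
  consider "i > n" | "i = n" | "i < n" by linarith
  note cs = this
  show "endo_apply (sl2_L_gen n Hgen * sl2_L_gen n Egen - sl2_L_gen n Egen * sl2_L_gen n Hgen) (basis_vec i)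
    = endo_apply (2 *\<^sub>C sl2_L_gen n Egen) (basis_vec i)"
    by (cases i) (auto simp: simps left_diff_distrib right_diff_distrib distrib_left distrib_right simp del: sl2_L_gen.simps complex_vector.scale_minus_left)
  show "endo_apply (sl2_L_gen n Hgen * sl2_L_gen n Fgen - sl2_L_gen n Fgen * sl2_L_gen n Hgen) (basis_vec i)
    = endo_apply ((- 2) *\<^sub>C sl2_L_gen n Fgen) (basis_vec i)"
    by (cases rule: cs) (auto simp: simps left_diff_distrib right_diff_distrib distrib_left distrib_right simp del: sl2_L_gen.simps complex_vector.scale_minus_left)
  show "endo_apply (sl2_L_gen n Egen * sl2_L_gen n Fgen - sl2_L_gen n Fgen * sl2_L_gen n Egen) (basis_vec i)
    = endo_apply (sl2_L_gen n Hgen) (basis_vec i)"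
    by (cases rule: cs; cases i) (auto simp: simps left_diff_distrib right_diff_distrib distrib_left distrib_right simp del: sl2_L_gen.simps complex_vector.scale_minus_left)
qed

lemma algebra_hom_sl2_L: "algebra_hom (sl2_L n)"
  unfolding sl2_L_def by (rule algebra_hom_presented_lift[OF satisfies_relations_sl2_L])

lemma sl2_L_basis:
  "endo_apply (sl2_L n sl2_E) (basis_vec i) = (if i \<le> n then of_nat i *\<^sub>C basis_vec (i - 1) else 0)"
  "endo_apply (sl2_L n sl2_F) (basis_vec i)
    = (if i \<le> n then (of_nat n - of_nat i) *\<^sub>C basis_vec (i + 1) else 0)"
  "endo_apply (sl2_L n sl2_H) (basis_vec i)
    = (if i \<le> n then (of_nat n - 2 * of_nat i) *\<^sub>C basis_vec i else 0)"
  unfolding sl2_L_def sl2_E_def sl2_F_def sl2_H_def presented_lift_gen[OF satisfies_relations_sl2_L]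
  by (rule sl2_L_gen_basis)+

lemma algebra_hom_LL: "algebra_hom (tensor_action (sl2_L m) (sl2_L n))"
  by (intro algebra_hom_tensor_action algebra_hom_sl2_L)

lemma LL_action_pure:
  "LL_action m n (x \<otimes>\<^sub>t y) (v \<otimes>\<^sub>t w) = endo_apply (sl2_L m x) v \<otimes>\<^sub>t endo_apply (sl2_L n y) w"
  by (simp add: LL_action_def tensor_action_pure algebra_hom_sl2_L)

lemma LL_action_simps:
  "LL_action m n (x + y) t = LL_action m n x t + LL_action m n y t"
  "LL_action m n (x - y) t = LL_action m n x t - LL_action m n y t"
  "LL_action m n (c *\<^sub>C x) t = c *\<^sub>C LL_action m n x t"
  "LL_action m n (x * y) t = LL_action m n x (LL_action m n y t)"
  "LL_action m n 1 t = t"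
  "LL_action m n x (s + t) = LL_action m n x s + LL_action m n x t"
  "LL_action m n x (s - t) = LL_action m n x s - LL_action m n x t"
  "LL_action m n x (c *\<^sub>C t) = c *\<^sub>C LL_action m n x t"
  "LL_action m n x 0 = 0"
  unfolding LL_action_def
  by (simp_all add: algebra_homD[OF algebra_hom_LL] endo_apply_simps endo_apply_linear)

section \<open>Coordinates and binomial inversion\<close>

lemma clinear_sum: "clinear f \<Longrightarrow> f (sum g S) = (\<Sum>i\<in>S. f (g i))"
  by (rule module_hom.sum[OF Vector_Spaces.linear.axioms(3)])

lemma lookup_scaleC [simp]: "Poly_Mapping.lookup (c *\<^sub>C p) i = c * Poly_Mapping.lookup p i"
  for p :: "'i \<Rightarrow>\<^sub>0 complex"
  by (simp add: scaleC_poly_mapping.rep_eq scaleC_complex_def)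

lemma lookup_basis_vec: "Poly_Mapping.lookup (basis_vec i) j = (if i = j then 1 else 0)"
  by (simp add: lookup_single when_def)

lemma lookup_basis_sum:
  "Poly_Mapping.lookup (\<Sum>k\<le>d. x k *\<^sub>C basis_vec k) j = (if j \<le> d then x j else (0::complex))"
  for d j :: nat
  by (simp add: lookup_sum lookup_basis_vec if_distrib[of "(*) _"] cong: if_cong)

lemma basis_sum_in_coord_space: "(\<Sum>k\<le>d. x k *\<^sub>C basis_vec k) \<in> coord_space d"
  unfolding coord_space_def
  by (intro complex_vector.span_sum complex_vector.span_scale complex_vector.span_base) auto

lemma coord_space_expand:
  assumes "v \<in> coord_space d"
  shows "v = (\<Sum>k\<le>d. Poly_Mapping.lookup v k *\<^sub>C basis_vec k)"
  using assms unfolding coord_space_def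
proof (induction rule: complex_vector.span_induct_alt)
  case (step c x y)
  then obtain i where i: "i \<le> d" "x = basis_vec i" by auto
  have "x = (\<Sum>k\<le>d. Poly_Mapping.lookup x k *\<^sub>C basis_vec k)"
    using i by (intro poly_mapping_eqI) (auto simp: lookup_basis_sum lookup_basis_vec)
  then have "c *\<^sub>C x + y = c *\<^sub>C (\<Sum>k\<le>d. Poly_Mapping.lookup x k *\<^sub>C basis_vec k)
      + (\<Sum>k\<le>d. Poly_Mapping.lookup y k *\<^sub>C basis_vec k)"
    using step(2) by simp
  also have "\<dots> = (\<Sum>k\<le>d. Poly_Mapping.lookup (c *\<^sub>C x + y) k *\<^sub>C basis_vec k)"
    by (simp add: lookup_add scaleC_add_left sum.distrib complex_vector.scale_sum_right)
  finally show ?case .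
qed simp

section \<open>Binomial identities\<close>

lemma absorb_choose:
  "of_nat (Suc k) * of_nat (n choose Suc k) = (of_nat n - of_nat k) * (of_nat (n choose k) :: complex)"
proof (cases "k \<le> n")
  case True
  have "Suc k * (n choose Suc k) = (n - k) * (n choose k)"
    by (metis binomial_absorb_comp binomial_absorption mult.commute)
  then show ?thesis
    using True by (metis of_nat_diff of_nat_mult)
qed (simp add: binomial_eq_0)

text \<open>Factoring out \<open>k choose r\<close> leaves the alternating sum of row
  \<open>k - r\<close> of Pascal's triangle, which is zero unless \<open>k = r\<close>. Terms with
  \<open>i > k\<close> vanish, so any bound \<open>N\<close> from \<open>k\<close> on will
  do.\<close>

lemma binomial_orthogonality:
  assumes "k \<le> N"
  shows "(\<Sum>i\<le>N. (- 1) ^ i * of_nat (k choose i) * of_nat (i choose r))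
    = (if k = r then (- 1) ^ k else (0 :: complex))"
proof (cases "r \<le> k")
  case True
  have "(\<Sum>i\<le>N. (- 1) ^ i * of_nat (k choose i) * of_nat (i choose r))
      = (\<Sum>i\<in>{r..k}. (- 1) ^ i * of_nat (k choose i) * (of_nat (i choose r) :: complex))"
    using assms by (intro sum.mono_neutral_right) (auto simp: binomial_eq_0)
  also have "\<dots> = (\<Sum>i\<in>{r..k}. (- 1) ^ i * (of_nat (k choose r) * of_nat ((k - r) choose (i - r))))"
    by (rule sum.cong) (auto simp: mult.assoc choose_mult simp flip: of_nat_mult)
  also have "\<dots> = (\<Sum>s\<le>k - r. (- 1) ^ (s + r) * (of_nat (k choose r) * of_nat ((k - r) choose s)))"
    by (rule sum.reindex_bij_witness[of _ "\<lambda>s. s + r" "\<lambda>i. i - r"]) (use True in auto)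
  also have "\<dots> = (- 1) ^ r * of_nat (k choose r) * (\<Sum>s\<le>k - r. (- 1) ^ s * of_nat ((k - r) choose s))"
    by (simp add: sum_distrib_left power_add algebra_simps)
  finally show ?thesis
    using True choose_alternating_sum[of "k - r", where ?'a = complex] by auto
next
  case False
  then have "(- 1) ^ i * of_nat (k choose i) * of_nat (i choose r) = (0 :: complex)" for i
    by (cases "i \<le> k") (auto simp: binomial_eq_0)
  then have "(\<Sum>i\<le>N. (- 1) ^ i * of_nat (k choose i) * of_nat (i choose r)) = (0 :: complex)"
    by (intro sum.neutral) blast
  with False show ?thesis by simp
qed

section \<open>Eigenbasis and split basis\<close>

text \<open>The entries p_i and, below, q_i of \<open>B\<close>. Since the differences are complex,
  p_i is zero at \<open>i = d\<close>, as q_i is at 0: the matrix stops at both ends by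
  itself.\<close>

definition raise_coeff :: "nat \<Rightarrow> nat \<Rightarrow> nat \<Rightarrow> complex" where
  "raise_coeff d e i = (of_nat d - of_nat i) * (of_nat e - of_nat i)"

definition lower_coeff :: "nat \<Rightarrow> nat \<Rightarrow> complex" where
  "lower_coeff h i = of_nat i * (of_nat i + of_nat h)"

definition raise_prod :: "nat \<Rightarrow> nat \<Rightarrow> nat \<Rightarrow> complex" where
  "raise_prod d e k = (\<Prod>s<k. raise_coeff d e s)"

lemma raise_coeff_nonzero: "d \<le> e \<Longrightarrow> i < d \<Longrightarrow> raise_coeff d e i \<noteq> 0"
  by (simp add: raise_coeff_def)

lemma raise_prod_nonzero: "d \<le> e \<Longrightarrow> k \<le> d \<Longrightarrow> raise_prod d e k \<noteq> 0"
  by (auto simp: raise_prod_def raise_coeff_nonzero)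

lemma raise_prod_Suc: "raise_prod d e (Suc k) = raise_prod d e k * raise_coeff d e k"
  by (simp add: raise_prod_def)

text \<open>The split basis \<open>v\<^sub>k\<close> of \<open>V\<^sub>d(a, b)\<close> and a suitably scaled \<open>A\<close>-eigenbasis \<open>u\<^sub>i\<close> are related by
  \<open>v\<^sub>k = p\<^sub>0 \<cdots> p\<^sub>k\<^sub>-\<^sub>1 \<Sum>\<^sub>i (-1)\<^sup>k\<^sup>-\<^sup>i (k choose i) u\<^sub>i\<close>: solving \<open>(A - \<theta>\<^sub>k) v\<^sub>k = \<phi>\<^sub>k v\<^sub>k\<^sub>-\<^sub>1\<close>
  with \<open>\<phi>\<^sub>k = - k p\<^sub>k\<^sub>-\<^sub>1\<close> leaves only the binomial coefficients.\<close>

definition eigen_of_split :: "nat \<Rightarrow> nat \<Rightarrow> (nat \<Rightarrow> 'v) \<Rightarrow> nat \<Rightarrow> 'v::complex_vector" where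
  "eigen_of_split d e x i = (\<Sum>k\<le>d. (of_nat (i choose k) / raise_prod d e k) *\<^sub>C x k)"

definition split_of_eigen :: "nat \<Rightarrow> nat \<Rightarrow> (nat \<Rightarrow> 'v) \<Rightarrow> nat \<Rightarrow> 'v::complex_vector" where
  "split_of_eigen d e u k = (\<Sum>i\<le>d. (raise_prod d e k * (- 1) ^ (k + i) * of_nat (k choose i)) *\<^sub>C u i)"

text \<open>After swapping the sums, orthogonality leaves only \<open>r = k\<close>, where the ratio
  of the products is 1 and the two signs cancel.\<close>

lemma split_of_eigen_of_split:
  assumes "d \<le> e" "k \<le> d"
  shows "split_of_eigen d e (eigen_of_split d e x) k = x k"
proof -
  have "split_of_eigen d e (eigen_of_split d e x) k
    = (\<Sum>r\<le>d. (\<Sum>i\<le>d. (raise_prod d e k * (- 1) ^ (k + i) * of_nat (k choose i))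
          * (of_nat (i choose r) / raise_prod d e r)) *\<^sub>C x r)"
    unfolding split_of_eigen_def eigen_of_split_def
    by (simp add: complex_vector.scale_sum_right complex_vector.scale_sum_left)
      (rule sum.swap)
  also have "\<dots> = (\<Sum>r\<le>d. (raise_prod d e k / raise_prod d e r * (- 1) ^ k
      * (\<Sum>i\<le>d. (- 1) ^ i * of_nat (k choose i) * of_nat (i choose r))) *\<^sub>C x r)"
    by (simp add: sum_distrib_left power_add mult_ac)
  also have "\<dots> = (\<Sum>r\<le>d. if k = r then x k else 0)"
    using raise_prod_nonzero[OF assms]
    by (intro sum.cong) (auto simp: binomial_orthogonality assms simp flip: power_add)
  finally show ?thesis using assms by simp
qed

text \<open>In this order the factors \<open>raise_prod\<close> cancel termwise, before
  orthogonality is applied.\<close>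

lemma eigen_of_split_of_eigen:
  assumes "d \<le> e" "i \<le> d"
  shows "eigen_of_split d e (split_of_eigen d e u) i = u i"
proof -
  have "eigen_of_split d e (split_of_eigen d e u) i
    = (\<Sum>r\<le>d. (\<Sum>k\<le>d. of_nat (i choose k) / raise_prod d e k
        * (raise_prod d e k * (- 1) ^ (k + r) * of_nat (k choose r))) *\<^sub>C u r)"
    unfolding split_of_eigen_def eigen_of_split_def
    by (simp add: complex_vector.scale_sum_right complex_vector.scale_sum_left)
      (rule sum.swap)
  also have "\<dots> = (\<Sum>r\<le>d. ((- 1) ^ r
      * (\<Sum>k\<le>d. (- 1) ^ k * of_nat (i choose k) * of_nat (k choose r))) *\<^sub>C u r)"
    using raise_prod_nonzero[OF assms(1)]
    by (intro sum.cong refl arg_cong2[of _ _ _ _ scaleC])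
      (simp add: sum_distrib_left power_add mult_ac)
  also have "\<dots> = (\<Sum>r\<le>d. if i = r then u i else 0)"
    by (intro sum.cong) (auto simp: binomial_orthogonality assms simp flip: power_add)
  finally show ?thesis using assms by simp
qed

section \<open>Matrices of A and B on V_d(a, b)\<close>

lemma lookup_hahn_V_A:
  "Poly_Mapping.lookup (endo_apply (hahn_V_A d a b) (\<Sum>k\<le>d. x k *\<^sub>C basis_vec k)) j
    = (if j \<le> d then hahn_theta a d j * x j + (if j < d then hahn_phi a b d (Suc j) * x (Suc j) else 0) else 0)"
proof -
  have "endo_apply (hahn_V_A d a b) (\<Sum>k\<le>d. x k *\<^sub>C basis_vec k)
    = (\<Sum>k\<le>d. x k *\<^sub>C (hahn_theta a d k *\<^sub>C basis_vec k
       + (if 1 \<le> k then hahn_phi a b d k *\<^sub>C basis_vec (k - 1) else 0)))"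
    unfolding clinear_sum[OF clinear_endo_apply]
    by (intro sum.cong) (simp_all add: hahn_V_A_def clinear_scale[OF clinear_linear_extension])
  also have "\<dots> = (\<Sum>k\<le>d. (x k * hahn_theta a d k) *\<^sub>C basis_vec k)
      + (\<Sum>k\<in>{1..d}. (x k * hahn_phi a b d k) *\<^sub>C basis_vec (k - 1))"
    by (simp add: scaleC_add_right sum.distrib if_distrib[of "scaleC _"] cong: if_cong)
      (rule sum.mono_neutral_cong_right; auto)
  also have "(\<Sum>k\<in>{1..d}. (x k * hahn_phi a b d k) *\<^sub>C basis_vec (k - 1))
      = (\<Sum>k<d. (x (Suc k) * hahn_phi a b d (Suc k)) *\<^sub>C basis_vec k)"
    by (rule sum.reindex_bij_witness[of _ Suc "\<lambda>k. k - 1"]) auto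
  finally show ?thesis
    by (auto simp: lookup_add lookup_basis_sum)
      (auto simp: lookup_sum lookup_basis_vec if_distrib[of "(*) _"] cong: if_cong)
qed

lemma lookup_hahn_V_B:
  "Poly_Mapping.lookup (endo_apply (hahn_V_B d b) (\<Sum>k\<le>d. x k *\<^sub>C basis_vec k)) j
    = (if j \<le> d then hahn_theta_star b j * x j + (if 1 \<le> j then x (j - 1) else 0) else 0)"
proof -
  have "endo_apply (hahn_V_B d b) (\<Sum>k\<le>d. x k *\<^sub>C basis_vec k)
    = (\<Sum>k\<le>d. x k *\<^sub>C (hahn_theta_star b k *\<^sub>C basis_vec k + (if k < d then basis_vec (k + 1) else 0)))"
    unfolding clinear_sum[OF clinear_endo_apply]
    by (intro sum.cong) (simp_all add: hahn_V_B_def clinear_scale[OF clinear_linear_extension])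
  also have "\<dots> = (\<Sum>k\<le>d. (x k * hahn_theta_star b k) *\<^sub>C basis_vec k)
      + (\<Sum>k<d. x k *\<^sub>C basis_vec (Suc k))"
    by (simp add: scaleC_add_right sum.distrib if_distrib[of "scaleC _"] cong: if_cong)
      (rule sum.mono_neutral_cong_right; auto)
  also have "(\<Sum>k<d. x k *\<^sub>C basis_vec (Suc k)) = (\<Sum>k\<le>d. (if 1 \<le> k then x (k - 1) else 0) *\<^sub>C basis_vec k)"
    by (rule sum.reindex_bij_witness_not_neutral[of "{}" "{0}" _ "\<lambda>k. k - 1" Suc]) auto
  finally show ?thesis
    by (auto simp: lookup_add lookup_basis_sum)
qed

text \<open>The hypothesis on \<open>a - b\<close> gives \<phi>_(j+1) = -(j+1) p_j, which cancels
  p_j in the denominator. Absorption turns the rest into \<open>-(i - j)\<close> times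
  \<open>i choose j\<close>, and \<theta>_j - (i - j) = \<theta>_i.\<close>

lemma hahn_V_A_eigen:
  assumes "d \<le> e" "a - b = of_nat e + 1" "i \<le> d"
  shows "endo_apply (hahn_V_A d a b) (eigen_of_split d e basis_vec i)
    = hahn_theta a d i *\<^sub>C eigen_of_split d e basis_vec i"
proof (rule poly_mapping_eqI)
  fix j
  have phi: "hahn_phi a b d (Suc j) = - (of_nat (Suc j) * raise_coeff d e j)"
    using assms(2) by (simp add: hahn_phi_def raise_coeff_def algebra_simps)
  consider "j > d" | "j = d" | "j < d" by linarith
  then show "Poly_Mapping.lookup (endo_apply (hahn_V_A d a b) (eigen_of_split d e basis_vec i)) j
      = Poly_Mapping.lookup (hahn_theta a d i *\<^sub>C eigen_of_split d e basis_vec i) j"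
  proof cases
    case 3
    have nz: "raise_coeff d e j \<noteq> 0" "raise_prod d e j \<noteq> 0"
      using 3 assms raise_coeff_nonzero raise_prod_nonzero by auto
    have "hahn_phi a b d (Suc j) * (of_nat (i choose Suc j) / raise_prod d e (Suc j))
      = - (of_nat (Suc j) * of_nat (i choose Suc j)) / raise_prod d e j"
      using nz by (simp add: phi raise_prod_Suc)
    also have "\<dots> = - ((of_nat i - of_nat j) * of_nat (i choose j)) / raise_prod d e j"
      unfolding absorb_choose ..
    finally have eq: "hahn_theta a d j * (of_nat (i choose j) / raise_prod d e j)
        + hahn_phi a b d (Suc j) * (of_nat (i choose Suc j) / raise_prod d e (Suc j))
        = hahn_theta a d i * (of_nat (i choose j) / raise_prod d e j)"
      using nz by (simp add: hahn_theta_def diff_divide_distrib algebra_simps)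
    show ?thesis
      unfolding eigen_of_split_def lookup_hahn_V_A lookup_scaleC lookup_basis_sum
      using 3 eq by simp
  next
    \<comment> \<open>The top coordinate receives nothing from above. For \<open>i < d\<close> the
      binomial \<open>i choose d\<close> is zero, so the differing eigenvalues do no harm.\<close>
    case 2
    then show ?thesis
      using assms
      by (cases "i = d") (simp_all add: eigen_of_split_def lookup_hahn_V_A lookup_basis_sum binomial_eq_0)
  qed (simp add: eigen_of_split_def lookup_hahn_V_A lookup_basis_sum)
qed

text \<open>Once \<open>raise_prod\<close> is cleared, Pascal's rule and absorption reduce all
  binomials to \<open>c\<close> and \<open>c'\<close>. At \<open>i = 0\<close> the truncated
  \<open>i - 1\<close> carries coefficient zero.\<close>

lemma hahn_V_B_eigen:
  assumes "d \<le> e" "b = - (of_nat d + of_nat e + of_nat h) / 2 - 1"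
  shows "endo_apply (hahn_V_B d b) (eigen_of_split d e basis_vec i)
    = (hahn_theta_star b 0 - raise_coeff d e i - lower_coeff h i) *\<^sub>C eigen_of_split d e basis_vec i
      + raise_coeff d e i *\<^sub>C eigen_of_split d e basis_vec (i + 1)
      + lower_coeff h i *\<^sub>C eigen_of_split d e basis_vec (i - 1)"
proof (rule poly_mapping_eqI)
  fix j
  \<comment> \<open>Nothing feeds into coordinate 0: there all binomials are 1, and the three
    coefficients on the right add up to \<open>hahn_theta_star b 0\<close>.\<close>
  consider "j > d" | "j = 0" | r where "j = Suc r" "r < d"
    by (metis Suc_le_lessD not_less not0_implies_Suc)
  then show "Poly_Mapping.lookup (endo_apply (hahn_V_B d b) (eigen_of_split d e basis_vec i)) j
    = Poly_Mapping.lookup ((hahn_theta_star b 0 - raise_coeff d e i - lower_coeff h i) *\<^sub>C eigen_of_split d e basis_vec i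
      + raise_coeff d e i *\<^sub>C eigen_of_split d e basis_vec (i + 1)
      + lower_coeff h i *\<^sub>C eigen_of_split d e basis_vec (i - 1)) j"
  proof cases
    case 3
    have nz: "raise_coeff d e r \<noteq> 0" "raise_prod d e r \<noteq> 0"
      using 3 assms raise_coeff_nonzero raise_prod_nonzero by auto
    define c c' where "c = (of_nat (i choose r) :: complex)" and "c' = (of_nat (i choose Suc r) :: complex)"
    have abs: "of_nat (Suc r) * c' = (of_nat i - of_nat r) * c"
      unfolding c_def c'_def by (rule absorb_choose)
    have theta: "hahn_theta_star b (Suc r) - hahn_theta_star b 0
        = of_nat (Suc r) * (of_nat r - of_nat d - of_nat e - of_nat h)"
      unfolding assms(2) hahn_theta_star_def by (simp add: field_simps)
    \<comment> \<open>Pascal's rule gives \<open>c'\<close> minus \<open>(i - 1) choose r\<close>;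
      multiplied by \<open>i\<close>, the latter becomes \<open>(i - r) * c\<close> by
      absorption.\<close>
    have low: "lower_coeff h i * of_nat ((i - 1) choose Suc r)
        = lower_coeff h i * c' - (of_nat i + of_nat h) * ((of_nat i - of_nat r) * c)"
    proof (cases i)
      case (Suc i')
      have "of_nat i * of_nat (i' choose r) = of_nat (Suc r) * c'"
        unfolding c'_def Suc by (metis Suc_times_binomial_eq mult.commute of_nat_mult)
      then have r: "(of_nat i - of_nat r) * c = of_nat i * of_nat (i' choose r)"
        using abs by simp
      have c': "c' = of_nat (i' choose r) + of_nat (i' choose Suc r)"
        unfolding c'_def Suc by simp
      show ?thesis
        unfolding r c' lower_coeff_def by (simp add: Suc algebra_simps)
    qed (auto simp: lower_coeff_def c_def)
    have "(hahn_theta_star b (Suc r) - hahn_theta_star b 0) * c' + raise_coeff d e r * c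
      = (of_nat r - of_nat d - of_nat e - of_nat h) * (of_nat (Suc r) * c') + raise_coeff d e r * c"
      unfolding theta by simp
    \<comment> \<open>Rests on p_r - p_i = (i - r)(d + e - i - r).\<close>
    also have "\<dots> = raise_coeff d e i * c - (of_nat i + of_nat h) * ((of_nat i - of_nat r) * c)"
      unfolding abs raise_coeff_def by (simp add: algebra_simps)
    finally have "hahn_theta_star b (Suc r) * c' + raise_coeff d e r * c
      = (hahn_theta_star b 0 - raise_coeff d e i - lower_coeff h i) * c'
        + raise_coeff d e i * (c + c') + lower_coeff h i * of_nat ((i - 1) choose Suc r)"
      unfolding low by (simp add: algebra_simps)
    then have "(hahn_theta_star b (Suc r) * c' + raise_coeff d e r * c) / raise_prod d e (Suc r)
      = ((hahn_theta_star b 0 - raise_coeff d e i - lower_coeff h i) * c'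
        + raise_coeff d e i * (c + c') + lower_coeff h i * of_nat ((i - 1) choose Suc r))
        / raise_prod d e (Suc r)"
      by simp
    then show ?thesis
      using 3 nz
      by (simp add: eigen_of_split_def lookup_hahn_V_B lookup_basis_sum lookup_add c_def c'_def
          raise_prod_Suc add_divide_distrib distrib_left)
  qed (auto simp: eigen_of_split_def lookup_hahn_V_B lookup_basis_sum lookup_add raise_prod_def)
qed

section \<open>Weight spaces of \<open>L\<^sub>m \<otimes> L\<^sub>n\<close>\<close>

text \<open>The functional dual to the basis tensor with indices \<open>i\<close>, \<open>j\<close>.
  Tensors being a quotient, it has to be induced by a bilinear map.\<close>

definition tensor_coord :: "nat \<Rightarrow> nat \<Rightarrow> (nat \<Rightarrow>\<^sub>0 complex, nat \<Rightarrow>\<^sub>0 complex) tensor \<Rightarrow> complex" where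
  "tensor_coord i j = tensor_lift (\<lambda>x y. Poly_Mapping.lookup x i * Poly_Mapping.lookup y j)"

lemma cbilinear_lookup_mult:
  "cbilinear (\<lambda>x y. Poly_Mapping.lookup x i * (Poly_Mapping.lookup y j :: complex))"
  by (rule cbilinearI) (simp_all add: lookup_add algebra_simps scaleC_complex_def)

lemma clinear_tensor_coord: "clinear (tensor_coord i j)"
  unfolding tensor_coord_def by (rule clinear_tensor_lift[OF cbilinear_lookup_mult])

lemma tensor_coord_pure:
  "tensor_coord i j (x \<otimes>\<^sub>t y) = Poly_Mapping.lookup x i * Poly_Mapping.lookup y j"
  unfolding tensor_coord_def by (rule tensor_lift_pure[OF cbilinear_lookup_mult])

lemma tensor_pure_sum_left: "sum f S \<otimes>\<^sub>t y = (\<Sum>i\<in>S. f i \<otimes>\<^sub>t y)"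
  by (induction S rule: infinite_finite_induct) (simp_all add: tensor_pure_simps)

lemma tensor_pure_sum_right: "x \<otimes>\<^sub>t sum f S = (\<Sum>i\<in>S. x \<otimes>\<^sub>t f i)"
  by (induction S rule: infinite_finite_induct) (simp_all add: tensor_pure_simps)

lemma basis_tensor_in_LL_space:
  "i \<le> m \<Longrightarrow> j \<le> n \<Longrightarrow> basis_vec i \<otimes>\<^sub>t basis_vec j \<in> LL_space m n"
  unfolding LL_space_def tensor_space_def coord_space_def
  by (intro complex_vector.span_base) (auto intro!: exI complex_vector.span_base)

lemma LL_space_expand:
  assumes "t \<in> LL_space m n"
  shows "t = (\<Sum>(i, j)\<in>{..m} \<times> {..n}. tensor_coord i j t *\<^sub>C (basis_vec i \<otimes>\<^sub>t basis_vec j))"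
  using assms unfolding LL_space_def tensor_space_def
proof (induction rule: complex_vector.span_induct_alt)
  case base
  show ?case by (simp add: clinear_zero[OF clinear_tensor_coord])
next
  case (step c s t)
  then obtain v w where vw: "v \<in> coord_space m" "w \<in> coord_space n" "s = v \<otimes>\<^sub>t w" by auto
  have "s = (\<Sum>i\<le>m. Poly_Mapping.lookup v i *\<^sub>C basis_vec i) \<otimes>\<^sub>t (\<Sum>j\<le>n. Poly_Mapping.lookup w j *\<^sub>C basis_vec j)"
    using coord_space_expand[OF vw(1)] coord_space_expand[OF vw(2)] vw(3) by simp
  also have "\<dots> = (\<Sum>(i, j)\<in>{..m} \<times> {..n}. tensor_coord i j s *\<^sub>C (basis_vec i \<otimes>\<^sub>t basis_vec j))"
    by (subst tensor_pure_sum_left) (simp add: vw(3) tensor_coord_pure tensor_pure_sum_right tensor_pure_simps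
        mult.commute sum.cartesian_product complex_vector.scale_sum_right)
  finally have "c *\<^sub>C s + t
      = c *\<^sub>C (\<Sum>(i, j)\<in>{..m} \<times> {..n}. tensor_coord i j s *\<^sub>C (basis_vec i \<otimes>\<^sub>t basis_vec j))
      + (\<Sum>(i, j)\<in>{..m} \<times> {..n}. tensor_coord i j t *\<^sub>C (basis_vec i \<otimes>\<^sub>t basis_vec j))"
    using step(2) by simp
  also have "\<dots> = (\<Sum>(i, j)\<in>{..m} \<times> {..n}. tensor_coord i j (c *\<^sub>C s + t) *\<^sub>C (basis_vec i \<otimes>\<^sub>t basis_vec j))"
    by (simp add: clinear_add[OF clinear_tensor_coord] clinear_scale[OF clinear_tensor_coord]
        scaleC_add_left sum.distrib complex_vector.scale_sum_right scaleC_complex_def case_prod_beta)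
  finally show ?case .
qed

section \<open>Operators on the basis tensors\<close>

lemma LL_action_Delta_H:
  assumes "i \<le> m" "j \<le> n"
  shows "LL_action m n (sl2_Delta sl2_H) (basis_vec i \<otimes>\<^sub>t basis_vec j)
    = (of_nat m + of_nat n - 2 * of_nat (i + j)) *\<^sub>C (basis_vec i \<otimes>\<^sub>t basis_vec j)"
  using assms
  by (simp add: sl2_Delta_simps LL_action_simps LL_action_pure sl2_L_basis algebra_homD[OF algebra_hom_sl2_L]
      endo_apply_simps tensor_pure_simps flip: scaleC_add_left)

text \<open>All three summands are diagonal, and their dependence on \<open>i\<close>
  cancels.\<close>

lemma sl2_L_Casimir:
  assumes "i \<le> n"
  shows "endo_apply (sl2_L n sl2_Casimir) (basis_vec i)
    = (of_nat n * (of_nat n + 2) / 2) *\<^sub>C basis_vec i"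
proof -
  have "endo_apply (sl2_L n (sl2_E * sl2_F)) (basis_vec i)
      = ((of_nat n - of_nat i) * (of_nat i + 1)) *\<^sub>C basis_vec i"
    using assms by (cases "i = n")
      (simp_all add: algebra_homD[OF algebra_hom_sl2_L] endo_apply_simps sl2_L_basis endo_apply_linear add.commute)
  moreover have "endo_apply (sl2_L n (sl2_F * sl2_E)) (basis_vec i)
      = (of_nat i * (of_nat n - of_nat i + 1)) *\<^sub>C basis_vec i"
    using assms by (cases i)
      (simp_all add: algebra_homD[OF algebra_hom_sl2_L] endo_apply_simps sl2_L_basis endo_apply_linear)
  moreover have "endo_apply (sl2_L n (sl2_H * sl2_H)) (basis_vec i)
      = ((of_nat n - 2 * of_nat i) * (of_nat n - 2 * of_nat i)) *\<^sub>C basis_vec i"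
    using assms
    by (simp add: algebra_homD[OF algebra_hom_sl2_L] endo_apply_simps sl2_L_basis endo_apply_linear)
  ultimately have "endo_apply (sl2_L n sl2_Casimir) (basis_vec i)
    = ((of_nat n - of_nat i) * (of_nat i + 1) + of_nat i * (of_nat n - of_nat i + 1)
      + 1/2 * ((of_nat n - 2 * of_nat i) * (of_nat n - 2 * of_nat i))) *\<^sub>C basis_vec i"
    unfolding sl2_Casimir_def algebra_homD(4,5)[OF algebra_hom_sl2_L] endo_apply_simps
    by (simp add: scaleC_add_left)
  also have "(of_nat n - of_nat i) * (of_nat i + 1) + of_nat i * (of_nat n - of_nat i + 1)
      + 1/2 * ((of_nat n - 2 * of_nat i) * (of_nat n - 2 * of_nat i))
      = (of_nat n * (of_nat n + 2) / 2 :: complex)"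
    by (simp add: field_simps)
  finally show ?thesis .
qed

text \<open>Separates the Casimirs of the two factors, which act by scalars on L_m and L_n, from the
  mixed terms, which are shifts or diagonal.\<close>

lemma half_Delta_Casimir:
  "(1/2) *\<^sub>C sl2_Delta sl2_Casimir = (1/2) *\<^sub>C (sl2_Casimir \<otimes>\<^sub>t 1) + (1/2) *\<^sub>C (1 \<otimes>\<^sub>t sl2_Casimir)
    + (sl2_E \<otimes>\<^sub>t sl2_F + sl2_F \<otimes>\<^sub>t sl2_E) + (1/2) *\<^sub>C (sl2_H \<otimes>\<^sub>t sl2_H)"
proof -
  let ?X = "sl2_E \<otimes>\<^sub>t sl2_F + sl2_F \<otimes>\<^sub>t sl2_E" and ?Y = "sl2_H \<otimes>\<^sub>t sl2_H"
  have "sl2_Delta sl2_Casimir = sl2_Casimir \<otimes>\<^sub>t 1 + 1 \<otimes>\<^sub>t sl2_Casimir + (?X + ?X)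
      + (1/2) *\<^sub>C (?Y + ?Y)"
    by (subst sl2_Delta_Casimir)
      (simp add: Let_def sl2_Delta_simps sl2_Casimir_def distrib_left distrib_right tensor_pure_mult tensor_pure_simps scaleC_add_right add_ac)
  also have "(1/2) *\<^sub>C (?Y + ?Y) = ?Y"
    by (simp only: scaleC_add_right half_double)
  finally have "(1/2) *\<^sub>C sl2_Delta sl2_Casimir
      = (1/2) *\<^sub>C (sl2_Casimir \<otimes>\<^sub>t 1 + 1 \<otimes>\<^sub>t sl2_Casimir + (?X + ?X) + ?Y)"
    by simp
  moreover have "(1/2) *\<^sub>C (p + q + (x + x) + y) = (1/2) *\<^sub>C p + (1/2) *\<^sub>C q + x + (1/2) *\<^sub>C y"
    for p q x y :: "(usl2, usl2) tensor"
    by (simp only: scaleC_add_right half_double)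
  ultimately show ?thesis by simp
qed

lemma LL_action_hahn_A:
  assumes "i \<le> m" "j \<le> n"
  shows "LL_action m n (hahn_natural (gen Agen)) (basis_vec i \<otimes>\<^sub>t basis_vec j)
    = ((of_nat m - of_nat n) / 4 - (of_nat i - of_nat j) / 2) *\<^sub>C (basis_vec i \<otimes>\<^sub>t basis_vec j)"
proof -
  have "LL_action m n (hahn_natural (gen Agen)) (basis_vec i \<otimes>\<^sub>t basis_vec j)
    = (1/4 * ((of_nat m - 2 * of_nat i) - (of_nat n - 2 * of_nat j))) *\<^sub>C (basis_vec i \<otimes>\<^sub>t basis_vec j)"
    using assms
    by (simp add: hahn_natural_gen LL_action_simps LL_action_pure sl2_L_basis
        algebra_homD[OF algebra_hom_sl2_L] endo_apply_simps tensor_pure_simps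
        flip: complex_vector.scale_left_diff_distrib)
  also have "1/4 * ((of_nat m - 2 * of_nat i) - (of_nat n - 2 * of_nat j))
      = ((of_nat m - of_nat n) / 4 - (of_nat i - of_nat j) / 2 :: complex)"
    by (simp add: field_simps)
  finally show ?thesis .
qed

lemma LL_action_hahn_B:
  assumes "i \<le> m" "j \<le> n"
  shows "LL_action m n (hahn_natural (gen Bgen)) (basis_vec i \<otimes>\<^sub>t basis_vec j)
    = (of_nat m * (of_nat m + 2) / 4 + of_nat n * (of_nat n + 2) / 4
        + (of_nat m - 2 * of_nat i) * (of_nat n - 2 * of_nat j) / 2) *\<^sub>C (basis_vec i \<otimes>\<^sub>t basis_vec j)
      + ((of_nat m - of_nat i) * of_nat j) *\<^sub>C (basis_vec (i + 1) \<otimes>\<^sub>t basis_vec (j - 1))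
      + (of_nat i * (of_nat n - of_nat j)) *\<^sub>C (basis_vec (i - 1) \<otimes>\<^sub>t basis_vec (j + 1))"
  using assms
  by (simp add: hahn_natural_gen half_Delta_Casimir LL_action_simps LL_action_pure sl2_L_basis
      sl2_L_Casimir algebra_homD[OF algebra_hom_sl2_L] endo_apply_simps tensor_pure_simps
      scaleC_add_left mult.commute)

text \<open>The pairs \<open>(i0 + i, j0 - i)\<close> run along an antidiagonal of the rectangle
  with sides \<open>m\<close> and \<open>n\<close>, entering at the edge \<open>i0 = 0\<close> or
  \<open>j0 = n\<close>. Its distances to the opposite edges are \<open>m - i0\<close> and
  \<open>j0\<close>; the smaller is \<open>d\<close>, the larger \<open>e\<close>, so p_i = (d -
  i)(e - i). Of \<open>i0\<close> and \<open>n - j0\<close> one is zero and the other is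
  \<open>h\<close>, so q_i = i(i + h).\<close>

locale weight_basis =
  fixes m n i0 j0 d e h :: nat
  assumes j0: "j0 \<le> n" and i0: "i0 \<le> m" and d_le_e: "d \<le> e"
    and de: "d = m - i0 \<and> e = j0 \<or> d = j0 \<and> e = m - i0"
    and h: "i0 = 0 \<and> h = n - j0 \<or> j0 = n \<and> h = i0"
begin

definition u :: "nat \<Rightarrow> (nat \<Rightarrow>\<^sub>0 complex, nat \<Rightarrow>\<^sub>0 complex) tensor" where
  "u i = basis_vec (i0 + i) \<otimes>\<^sub>t basis_vec (j0 - i)"

definition "W = weight_space (LL_space m n) (LL_action m n) (of_nat m + of_nat n - 2 * of_nat (i0 + j0))"

text \<open>Together these give d + e + h = m + n, which identifies the two expressions for
  \<open>b\<close>.\<close>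

lemma parameter_sums:
  "of_nat d + of_nat e = of_nat m - of_nat i0 + (of_nat j0 :: complex)"
  "of_nat h = of_nat n - of_nat j0 + (of_nat i0 :: complex)"
  using de h i0 j0 by (auto simp: of_nat_diff)

lemma index_le: "i \<le> d \<Longrightarrow> i0 + i \<le> m" "i \<le> d \<Longrightarrow> i \<le> j0" "i \<le> d \<Longrightarrow> j0 - i \<le> n"
  using j0 i0 d_le_e de by auto

lemma u_in_W: "i \<le> d \<Longrightarrow> u i \<in> W"
  using index_le
  by (simp add: W_def weight_space_def u_def basis_tensor_in_LL_space LL_action_Delta_H)

lemma subspace_W: "csubspace W"
  unfolding W_def weight_space_def
  by (rule complex_vector.subspaceI)
    (auto simp: LL_action_simps scaleC_add_right mult.commute LL_space_def tensor_space_def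
      intro: complex_vector.span_zero complex_vector.span_add complex_vector.span_scale)

text \<open>\<Delta>(H) is diagonal on basis tensors with an eigenvalue that determines
  \<open>i + j\<close>, so a weight vector is supported on one antidiagonal.\<close>

lemma W_expand:
  assumes t: "t \<in> W"
  shows "t = (\<Sum>i\<le>d. tensor_coord (i0 + i) (j0 - i) t *\<^sub>C u i)"
proof -
  let ?b = "\<lambda>i j. basis_vec i \<otimes>\<^sub>t basis_vec j :: (nat \<Rightarrow>\<^sub>0 complex, nat \<Rightarrow>\<^sub>0 complex) tensor"
  let ?w = "\<lambda>k::nat. of_nat m + of_nat n - 2 * of_nat k :: complex"
  have tL: "t \<in> LL_space m n" and tH: "LL_action m n (sl2_Delta sl2_H) t = ?w (i0 + j0) *\<^sub>C t"
    using t by (auto simp: W_def weight_space_def)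
  note lin = clinear_sum[OF clinear_tensor_coord] clinear_scale[OF clinear_tensor_coord]
  have "clinear (LL_action m n x)" for x
    by (rule clinearI) (simp_all add: LL_action_simps)
  note act_sum = clinear_sum[OF this]
  have zero: "tensor_coord i j t = 0" if "i \<le> m" "j \<le> n" "i + j \<noteq> i0 + j0" for i j
  proof -
    have "?w (i0 + j0) * tensor_coord i j t = tensor_coord i j (LL_action m n (sl2_Delta sl2_H) t)"
      unfolding tH by (simp add: lin scaleC_complex_def)
    also have "LL_action m n (sl2_Delta sl2_H) t
      = (\<Sum>p\<in>{..m} \<times> {..n}. (tensor_coord (fst p) (snd p) t * ?w (fst p + snd p)) *\<^sub>C ?b (fst p) (snd p))"
      by (subst LL_space_expand[OF tL])
        (auto simp: act_sum case_prod_beta LL_action_simps LL_action_Delta_H intro!: sum.cong)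
    also have "tensor_coord i j \<dots> = (\<Sum>p\<in>{..m} \<times> {..n}. if p = (i, j) then tensor_coord i j t * ?w (i + j) else 0)"
      unfolding lin
      by (intro sum.cong) (auto simp: tensor_coord_pure lookup_basis_vec scaleC_complex_def)
    also have "\<dots> = tensor_coord i j t * ?w (i + j)"
      using that by simp
    finally have "tensor_coord i j t * (?w (i0 + j0) - ?w (i + j)) = 0"
      by (simp add: algebra_simps)
    moreover have "?w (i0 + j0) - ?w (i + j) = 2 * (of_nat (i + j) - of_nat (i0 + j0))"
      by (simp add: algebra_simps)
    ultimately show ?thesis
      using that(3) by (metis mult_eq_0_iff of_nat_eq_iff right_minus_eq zero_neq_numeral)
  qed
  \<comment> \<open>The antidiagonal cannot be prolonged before its start, where
    \<open>i0 = 0\<close> or \<open>j0 = n\<close>, nor past \<open>d\<close>, the distance to the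
    nearer opposite edge.\<close>
  have idx: "i0 \<le> i" "i - i0 \<le> d" "j0 - (i - i0) = j" if "i \<le> m" "j \<le> n" "i + j = i0 + j0" for i j
    using that j0 i0 d_le_e de h by auto
  have "t = (\<Sum>(i, j)\<in>{..m} \<times> {..n}. tensor_coord i j t *\<^sub>C ?b i j)"
    by (rule LL_space_expand[OF tL])
  also have "\<dots> = (\<Sum>(i, j)\<in>{(i, j). i \<le> m \<and> j \<le> n \<and> i + j = i0 + j0}. tensor_coord i j t *\<^sub>C ?b i j)"
    by (rule sum.mono_neutral_right) (auto, use zero in blast)
  also have "\<dots> = (\<Sum>i\<le>d. tensor_coord (i0 + i) (j0 - i) t *\<^sub>C u i)"
    by (rule sum.reindex_bij_witness[of _ "\<lambda>r. (i0 + r, j0 - r)" "\<lambda>(i, j). i - i0"])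
      (use idx index_le in \<open>auto simp: u_def\<close>)
  finally show ?thesis .
qed

lemma A_u:
  assumes "i \<le> d" "a = of_nat m / 2 - of_nat n / 2 + of_nat j0 - of_nat i0 - of_nat d"
  shows "LL_action m n (hahn_natural (gen Agen)) (u i) = hahn_theta a d i *\<^sub>C u i"
proof -
  have "(of_nat m - of_nat n) / 4 - (of_nat (i0 + i) - of_nat (j0 - i)) / 2 = hahn_theta a d i"
    using index_le[OF assms(1)] unfolding assms(2) hahn_theta_def
    by (simp add: of_nat_diff field_simps)
  then show ?thesis
    using LL_action_hahn_A[OF index_le(1,3)[OF assms(1)]] by (simp add: u_def)
qed

lemma B_u:
  assumes "i \<le> d" "b = - (of_nat m + of_nat n) / 2 - 1"
  shows "LL_action m n (hahn_natural (gen Bgen)) (u i)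
    = (hahn_theta_star b 0 - raise_coeff d e i - lower_coeff h i) *\<^sub>C u i
      + raise_coeff d e i *\<^sub>C u (i + 1) + lower_coeff h i *\<^sub>C u (i - 1)"
proof -
  have j: "of_nat (j0 - i) = of_nat j0 - (of_nat i :: complex)"
    using index_le[OF assms(1)] by (simp add: of_nat_diff)
  have raise: "(of_nat m - of_nat (i0 + i)) * of_nat (j0 - i) = raise_coeff d e i"
    using de i0 unfolding j by (auto simp: raise_coeff_def of_nat_diff algebra_simps)
  have lower: "of_nat (i0 + i) * (of_nat n - of_nat (j0 - i)) = lower_coeff h i"
    using h j0 unfolding j by (auto simp: lower_coeff_def of_nat_diff algebra_simps)
  have diag: "of_nat m * (of_nat m + 2) / 4 + of_nat n * (of_nat n + 2) / 4
        + (of_nat m - 2 * of_nat (i0 + i)) * (of_nat n - 2 * of_nat (j0 - i)) / 2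
      = hahn_theta_star b 0 - raise_coeff d e i - lower_coeff h i"
    unfolding raise[symmetric] lower[symmetric] hahn_theta_star_def assms(2)
    by (simp add: field_simps)
  \<comment> \<open>At \<open>i = 0\<close> truncated subtraction makes the two vectors differ, but
    \<open>lower_coeff h 0\<close> is zero.\<close>
  have "lower_coeff h i *\<^sub>C (basis_vec (i0 + i - 1) \<otimes>\<^sub>t basis_vec (j0 - i + 1)) = lower_coeff h i *\<^sub>C u (i - 1)"
    using index_le(2)[OF assms(1)] by (cases i) (simp_all add: u_def lower_coeff_def Suc_diff_Suc)
  then show ?thesis
    using LL_action_hahn_B[OF index_le(1,3)[OF assms(1)]] unfolding diag raise lower
    by (simp add: u_def)
qed

end

section \<open>The isomorphism\<close>

text \<open>Closure and intertwining are proved together: in a product, the outer factor can be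
  handled only once the inner one has led back into \<open>W\<close>.\<close>

lemma alg_eval_intertwine:
  assumes W: "csubspace W" and f: "clinear f"
    and closed: "\<And>g w. w \<in> W \<Longrightarrow> endo_apply (r g) w \<in> W"
    and gen: "\<And>g w. w \<in> W \<Longrightarrow> f (endo_apply (r g) w) = endo_apply (s g) (f w)"
    and "w \<in> W"
  shows "endo_apply (alg_eval r e) w \<in> W \<and> f (endo_apply (alg_eval r e) w) = endo_apply (alg_eval s e) (f w)"
  using \<open>w \<in> W\<close>
proof (induction e arbitrary: w)
  case (Const c)
  then show ?case
    by (simp add: endo_apply_simps clinear_scale[OF f] complex_vector.subspace_scale[OF W])
next
  case (Add x y)
  then show ?case
    by (simp add: endo_apply_simps clinear_add[OF f] complex_vector.subspace_add[OF W])
qed (simp_all add: endo_apply_simps closed gen)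

lemma algebra_module_endo:
  assumes R: "algebra_hom R" and V: "csubspace V" and "\<And>x v. v \<in> V \<Longrightarrow> endo_apply (R x) v \<in> V"
  shows "algebra_module V (\<lambda>x. endo_apply (R x))"
  using assms
  by unfold_locales (simp_all add: algebra_homD[OF R] endo_apply_simps endo_apply_linear)

text \<open>Applying \<open>A\<close> minus \<theta>_j removes component \<open>j\<close> and
  rescales the others by nonzero factors, so induction isolates them; component \<open>j\<close> is
  what remains of the sum.\<close>

lemma eigenvector_components_in_invariant_subspace:
  assumes U: "csubspace U" and A: "clinear A" "\<And>x. x \<in> U \<Longrightarrow> A x \<in> U"
    and "finite I" "inj_on \<theta> I" "\<And>i. i \<in> I \<Longrightarrow> A (z i) = \<theta> i *\<^sub>C z i"
    and "(\<Sum>i\<in>I. c i *\<^sub>C z i) \<in> U" "i \<in> I"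
  shows "c i *\<^sub>C z i \<in> U"
  using assms(4-)
proof (induction I arbitrary: c i rule: finite_induct)
  case (insert j I)
  let ?t = "\<Sum>i\<in>insert j I. c i *\<^sub>C z i"
  have "A ?t - \<theta> j *\<^sub>C ?t = (\<Sum>i\<in>insert j I. (c i * (\<theta> i - \<theta> j)) *\<^sub>C z i)"
    using insert.prems(2)
    by (simp add: clinear_sum[OF A(1)] clinear_scale[OF A(1)] complex_vector.scale_sum_right mult.commute
        complex_vector.scale_left_diff_distrib right_diff_distrib del: sum.insert flip: sum_subtractf)
  also have "\<dots> = (\<Sum>i\<in>I. (c i * (\<theta> i - \<theta> j)) *\<^sub>C z i)"
    using insert.hyps by simp
  finally have "(\<Sum>i\<in>I. (c i * (\<theta> i - \<theta> j)) *\<^sub>C z i) \<in> U"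
    using complex_vector.subspace_diff[OF U A(2) complex_vector.subspace_scale[OF U]] insert.prems(3)
    by metis
  then have *: "(c k * (\<theta> k - \<theta> j)) *\<^sub>C z k \<in> U" if "k \<in> I" for k
    using insert.IH[of "\<lambda>i. c i * (\<theta> i - \<theta> j)"] insert.prems(1,2) that
    by (simp add: inj_on_insert)
  have I: "c k *\<^sub>C z k \<in> U" if "k \<in> I" for k
  proof -
    have "\<theta> k \<noteq> \<theta> j" using insert.prems(1) insert.hyps that by (auto simp: inj_on_def)
    then have "c k *\<^sub>C z k = (1 / (\<theta> k - \<theta> j)) *\<^sub>C ((c k * (\<theta> k - \<theta> j)) *\<^sub>C z k)"
      by simp
    then show ?thesis using complex_vector.subspace_scale[OF U *[OF that]] by metis
  qed
  have "c j *\<^sub>C z j = ?t - (\<Sum>i\<in>I. c i *\<^sub>C z i)"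
    using insert.hyps by simp
  then have "c j *\<^sub>C z j \<in> U"
    using complex_vector.subspace_diff[OF U insert.prems(3) complex_vector.subspace_sum[OF U I]] by simp
  with I insert.prems(4) show ?case by auto
qed simp

lemma subspace_scale_cancel:
  assumes "csubspace U" "c *\<^sub>C x \<in> U" "c \<noteq> 0"
  shows "x \<in> U"
  using complex_vector.subspace_scale[OF assms(1,2), of "1 / c"] assms(3) by simp

lemma inj_hahn_theta: "inj_on (hahn_theta a d) I"
  by (auto simp: inj_on_def hahn_theta_def)

text \<open>Reduces intertwining to the generators A and B.\<close>

lemma hahn_C_eq:
  assumes "algebra_hom R"
  shows "R (gen Cgen) = commutator (R (gen Agen)) (R (gen Bgen))"
proof -
  have "(Comm (Gen Agen) (Gen Bgen), Gen Cgen) \<in> relations"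
    by (simp add: relations_hahn_gen_def)
  then have "alg_eval (\<lambda>g. R (gen g)) (Comm (Gen Agen) (Gen Bgen)) = alg_eval (\<lambda>g. R (gen g)) (Gen Cgen)"
    using satisfies_relations_algebra_hom[OF assms] by (auto simp: satisfies_relations_def)
  then show ?thesis by (simp add: commutator_def)
qed

section \<open>Basis vectors beyond the carrier\<close>

lemma hahn_V_gen_outside: "d < k \<Longrightarrow> endo_apply (hahn_V_gen d a b g) (basis_vec k) = 0"
  by (cases g) (simp_all add: hahn_V_A_def hahn_V_B_def commutator_def endo_apply_simps
      clinear_zero[OF clinear_linear_extension])

lemma alg_eval_killed:
  assumes "\<And>g. endo_apply (s g) v = 0"
  shows "\<exists>c. endo_apply (alg_eval s e) v = c *\<^sub>C v"
proof (induction e)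
  case (Gen g)
  then show ?case by (intro exI[of _ 0]) (simp add: assms)
next
  case (Add x y)
  then show ?case by (auto simp: endo_apply_simps simp flip: scaleC_add_left)
next
  case (Mul x y)
  then obtain p q where "endo_apply (alg_eval s x) v = p *\<^sub>C v" "endo_apply (alg_eval s y) v = q *\<^sub>C v"
    by auto
  then show ?case by (intro exI[of _ "q * p"]) (simp add: endo_apply_simps endo_apply_linear)
qed (auto simp: endo_apply_simps)

text \<open>\<alpha> and \<beta> have no constant term and hence kill \<open>v\<close>; every
  expression maps \<open>v\<close> to a multiple of itself, so both sides of each relation give 0.
  The relations have to hold as endomorphisms of the whole ambient space, which contains such
  vectors.\<close>

lemma hahn_relations_killed:
  fixes s :: "hahn_gen \<Rightarrow> 'v::complex_vector endo"
  assumes kill: "\<And>g. endo_apply (s g) v = 0" and "(x, y) \<in> relations"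
  shows "endo_apply (alg_eval s x) v = endo_apply (alg_eval s y) v"
proof -
  have "endo_apply (alg_eval s hahn_alpha) v = 0" "endo_apply (alg_eval s hahn_beta) v = 0"
    by (simp_all add: hahn_alpha_def hahn_beta_def endo_apply_simps endo_apply_linear kill)
  moreover from this have "endo_apply (alg_eval s hahn_alpha) (endo_apply (alg_eval s w) v) = 0"
    "endo_apply (alg_eval s hahn_beta) (endo_apply (alg_eval s w) v) = 0" for w
    using alg_eval_killed[of s v w, OF kill] by (auto simp: endo_apply_linear)
  ultimately show ?thesis
    using assms(2) by (auto simp: relations_hahn_gen_def endo_apply_simps endo_apply_linear kill)
qed

section \<open>Transport between the weight space and V_d(a, b)\<close>

context weight_basis
begin

definition z :: "nat \<Rightarrow> (nat \<Rightarrow>\<^sub>0 complex)" where "z = eigen_of_split d e basis_vec"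

text \<open>Only coordinates along the weight segment are read, which makes the map linear on the
  whole ambient space; for \<open>i \<le> d\<close> it sends \<open>u i\<close> to
  \<open>z i\<close>.\<close>

definition to_V :: "(nat \<Rightarrow>\<^sub>0 complex, nat \<Rightarrow>\<^sub>0 complex) tensor \<Rightarrow> (nat \<Rightarrow>\<^sub>0 complex)" where
  "to_V t = (\<Sum>i\<le>d. tensor_coord (i0 + i) (j0 - i) t *\<^sub>C z i)"

definition from_V :: "(nat \<Rightarrow>\<^sub>0 complex) \<Rightarrow> (nat \<Rightarrow>\<^sub>0 complex, nat \<Rightarrow>\<^sub>0 complex) tensor" where
  "from_V = linear_extension (split_of_eigen d e u)"

definition rep :: "hahn \<Rightarrow> (nat \<Rightarrow>\<^sub>0 complex, nat \<Rightarrow>\<^sub>0 complex) tensor endo" where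
  "rep x = tensor_action (sl2_L m) (sl2_L n) (hahn_natural x)"

lemma LL_action_rep: "LL_action m n (hahn_natural x) = endo_apply (rep x)"
  by (simp add: LL_action_def rep_def)

lemma algebra_hom_rep: "algebra_hom rep"
  unfolding rep_def by (rule algebra_hom_compose[OF algebra_hom_LL algebra_hom_hahn_natural])

lemma z_in: "z i \<in> coord_space d"
  unfolding z_def eigen_of_split_def by (rule basis_sum_in_coord_space)

lemma clinear_to_V: "clinear to_V"
  by (rule clinearI)
    (simp_all add: to_V_def clinear_add[OF clinear_tensor_coord] clinear_scale[OF clinear_tensor_coord]
      scaleC_add_left sum.distrib complex_vector.scale_sum_right scaleC_complex_def)

lemma clinear_from_V: "clinear from_V"
  unfolding from_V_def by (rule clinear_linear_extension)

lemma to_V_u: "i \<le> d \<Longrightarrow> to_V (u i) = z i"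
proof -
  assume i: "i \<le> d"
  have "to_V (u i) = (\<Sum>k\<le>d. if k = i then z i else 0)"
    unfolding to_V_def u_def
    by (intro sum.cong) (auto simp: tensor_coord_pure lookup_basis_vec)
  then show ?thesis using i by simp
qed

lemma subspace_coord_space: "csubspace (coord_space d)"
  unfolding coord_space_def by (rule complex_vector.subspace_span)

lemma to_V_in: "to_V t \<in> coord_space d"
  unfolding to_V_def
  by (intro complex_vector.subspace_sum[OF subspace_coord_space]
      complex_vector.subspace_scale[OF subspace_coord_space] z_in)

lemma split_of_eigen_u_in: "split_of_eigen d e u k \<in> W"
  unfolding split_of_eigen_def
  by (intro complex_vector.subspace_sum[OF subspace_W] complex_vector.subspace_scale[OF subspace_W] u_in_W) simp

lemma from_V_in: "from_V p \<in> W"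
  unfolding from_V_def linear_extension_def
  by (intro complex_vector.subspace_sum[OF subspace_W] complex_vector.subspace_scale[OF subspace_W]
      split_of_eigen_u_in)

lemma from_V_basis: "from_V (basis_vec k) = split_of_eigen d e u k"
  by (simp add: from_V_def)

text \<open>The combination of the \<open>u i\<close> that defines \<open>from_V\<close> becomes the
  same combination of the \<open>z i\<close>, which is \<open>basis_vec k\<close> by binomial
  inversion.\<close>

lemma to_from_V:
  assumes "p \<in> coord_space d"
  shows "to_V (from_V p) = p"
proof -
  have "to_V (from_V (basis_vec k)) = basis_vec k" if "k \<le> d" for k
  proof -
    have "to_V (from_V (basis_vec k)) = split_of_eigen d e z k"
      unfolding from_V_basis split_of_eigen_def
      by (simp add: clinear_sum[OF clinear_to_V] clinear_scale[OF clinear_to_V] to_V_u)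
    then show ?thesis
      using that d_le_e by (simp add: z_def split_of_eigen_of_split)
  qed
  then show ?thesis
    by (subst (1 2) coord_space_expand[OF assms])
      (simp add: clinear_sum[OF clinear_to_V] clinear_scale[OF clinear_to_V]
        clinear_sum[OF clinear_from_V] clinear_scale[OF clinear_from_V])
qed

lemma from_to_V:
  assumes "t \<in> W"
  shows "from_V (to_V t) = t"
proof -
  have "from_V (z i) = u i" if "i \<le> d" for i
    using that d_le_e eigen_of_split_of_eigen[of d e i u]
    by (simp add: z_def eigen_of_split_def clinear_sum[OF clinear_from_V] clinear_scale[OF clinear_from_V]
        from_V_basis)
  then show ?thesis
    by (subst (2) W_expand[OF assms])
      (simp add: to_V_def clinear_sum[OF clinear_from_V] clinear_scale[OF clinear_from_V])
qed

lemma bij_to_V: "bij_betw to_V W (coord_space d)"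
  by (rule bij_betw_byWitness[of _ from_V]) (auto simp: to_from_V from_to_V to_V_in from_V_in)

text \<open>\<open>a\<close> makes (a + d)/2 the eigenvalue of A on \<open>u 0\<close>; together
  with \<open>b\<close> it satisfies \<open>a - b = e + 1\<close>.\<close>

context
  fixes a b :: complex
  assumes a: "a = of_nat m / 2 - of_nat n / 2 + of_nat j0 - of_nat i0 - of_nat d"
    and b: "b = - (of_nat m + of_nat n) / 2 - 1"
begin

lemma A_z:
  assumes "i \<le> d"
  shows "endo_apply (hahn_V_A d a b) (z i) = hahn_theta a d i *\<^sub>C z i"
proof -
  have "a - b = (of_nat m - of_nat i0 + of_nat j0) - of_nat d + 1"
    unfolding a b by (simp add: field_simps)
  then have "a - b = of_nat e + 1"
    by (simp flip: parameter_sums(1))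
  then show ?thesis
    unfolding z_def using assms d_le_e by (intro hahn_V_A_eigen)
qed

lemma B_z: "endo_apply (hahn_V_B d b) (z i)
    = (hahn_theta_star b 0 - raise_coeff d e i - lower_coeff h i) *\<^sub>C z i
      + raise_coeff d e i *\<^sub>C z (i + 1) + lower_coeff h i *\<^sub>C z (i - 1)"
  unfolding z_def
  by (rule hahn_V_B_eigen) (simp_all add: d_le_e b parameter_sums)

lemma endo_W_intertwine:
  assumes u: "\<And>i. i \<le> d \<Longrightarrow> endo_apply x (u i) \<in> W \<and> to_V (endo_apply x (u i)) = endo_apply y (z i)"
    and t: "t \<in> W"
  shows "endo_apply x t \<in> W \<and> to_V (endo_apply x t) = endo_apply y (to_V t)"
proof -
  have "endo_apply x t = (\<Sum>i\<le>d. tensor_coord (i0 + i) (j0 - i) t *\<^sub>C endo_apply x (u i))"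
    by (subst W_expand[OF t]) (simp add: clinear_sum[OF clinear_endo_apply] endo_apply_linear)
  then show ?thesis
    by (auto simp: to_V_def[of t] clinear_sum[OF clinear_endo_apply] endo_apply_linear
        clinear_sum[OF clinear_to_V] clinear_scale[OF clinear_to_V] u
        intro!: complex_vector.subspace_sum[OF subspace_W] complex_vector.subspace_scale[OF subspace_W])
qed

lemma rep_gen_intertwine:
  assumes "t \<in> W"
  shows "endo_apply (rep (gen g)) t \<in> W
    \<and> to_V (endo_apply (rep (gen g)) t) = endo_apply (hahn_V_gen d a b g) (to_V t)"
proof -
  note W_closed = complex_vector.subspace_add[OF subspace_W] complex_vector.subspace_scale[OF subspace_W]
  have A: "endo_apply (rep (gen Agen)) t \<in> W
    \<and> to_V (endo_apply (rep (gen Agen)) t) = endo_apply (hahn_V_A d a b) (to_V t)" if "t \<in> W" for t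
  proof (rule endo_W_intertwine[OF _ that])
    fix i assume "i \<le> d"
    then show "endo_apply (rep (gen Agen)) (u i) \<in> W
      \<and> to_V (endo_apply (rep (gen Agen)) (u i)) = endo_apply (hahn_V_A d a b) (z i)"
      using A_u[OF _ a] A_z u_in_W
      by (simp add: LL_action_rep W_closed clinear_scale[OF clinear_to_V] to_V_u)
  qed
  have B: "endo_apply (rep (gen Bgen)) t \<in> W
    \<and> to_V (endo_apply (rep (gen Bgen)) t) = endo_apply (hahn_V_B d b) (to_V t)" if "t \<in> W" for t
  proof (rule endo_W_intertwine[OF _ that])
    fix i assume i: "i \<le> d"
    \<comment> \<open>For \<open>i = d\<close> the vector \<open>u (i + 1)\<close> falls off the
      weight basis, but its coefficient is zero.\<close>
    have "raise_coeff d e i *\<^sub>C u (i + 1) \<in> W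
        \<and> to_V (raise_coeff d e i *\<^sub>C u (i + 1)) = raise_coeff d e i *\<^sub>C z (i + 1)"
    proof (cases "i = d")
      case True
      then show ?thesis
        by (simp add: raise_coeff_def clinear_zero[OF clinear_to_V] complex_vector.subspace_0[OF subspace_W])
    next
      case False
      with i show ?thesis by (simp add: W_closed u_in_W clinear_scale[OF clinear_to_V] to_V_u)
    qed
    then show "endo_apply (rep (gen Bgen)) (u i) \<in> W
      \<and> to_V (endo_apply (rep (gen Bgen)) (u i)) = endo_apply (hahn_V_B d b) (z i)"
      using B_u[OF i b] B_z[of i] i u_in_W
      by (simp add: LL_action_rep W_closed clinear_add[OF clinear_to_V] clinear_scale[OF clinear_to_V] to_V_u)
  qed
  show ?thesis
    using A B assms
    by (cases g) (simp_all add: hahn_C_eq[OF algebra_hom_rep] commutator_def endo_apply_simps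
        clinear_diff[OF clinear_to_V] complex_vector.subspace_diff[OF subspace_W])
qed

lemma rep_alg_eval_intertwine:
  assumes "t \<in> W"
  shows "endo_apply (alg_eval (\<lambda>g. rep (gen g)) x) t \<in> W
    \<and> to_V (endo_apply (alg_eval (\<lambda>g. rep (gen g)) x) t) = endo_apply (alg_eval (hahn_V_gen d a b) x) (to_V t)"
  by (rule alg_eval_intertwine[OF subspace_W clinear_to_V _ _ assms]) (simp_all add: rep_gen_intertwine)

text \<open>The relations are transported along \<open>to_V\<close> from the weight space, where they hold because
  \<open>\<natural>\<close> is a homomorphism; basis vectors beyond \<open>v\<^sub>d\<close> are killed by all generators.\<close>

lemma satisfies_relations_hahn_V: "satisfies_relations (hahn_V_gen d a b)"
  unfolding satisfies_relations_def
proof clarify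
  fix x y :: "hahn_gen alg_expr"
  assume xy: "(x, y) \<in> relations"
  show "alg_eval (hahn_V_gen d a b) x = alg_eval (hahn_V_gen d a b) y"
  proof (rule endo_free_eqI)
    fix k
    show "endo_apply (alg_eval (hahn_V_gen d a b) x) (basis_vec k)
      = endo_apply (alg_eval (hahn_V_gen d a b) y) (basis_vec k)"
    proof (cases "k \<le> d")
      case True
      then have "basis_vec k \<in> coord_space d"
        unfolding coord_space_def by (intro complex_vector.span_base) auto
      then obtain t where "t \<in> W" "basis_vec k = to_V t"
        using to_from_V from_V_in by metis
      moreover have "alg_eval (\<lambda>g. rep (gen g)) x = alg_eval (\<lambda>g. rep (gen g)) y"
        using satisfies_relations_algebra_hom[OF algebra_hom_rep] xy by (auto simp: satisfies_relations_def)
      ultimately show ?thesis using rep_alg_eval_intertwine by metis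
    next
      case False
      then show ?thesis by (intro hahn_relations_killed[OF hahn_V_gen_outside xy]) simp
    qed
  qed
qed

lemma rep_intertwine:
  assumes "t \<in> W"
  shows "endo_apply (rep x) t \<in> W \<and> to_V (endo_apply (rep x) t) = hahn_V_action d a b x (to_V t)"
proof -
  obtain ex where ex: "x = abs_presented ex" using abs_presented_ex by blast
  show ?thesis
    using rep_alg_eval_intertwine[OF assms, of ex]
    by (simp add: ex hahn_V_action_def algebra_hom_abs_presented[OF algebra_hom_rep]
        presented_lift_abs[OF satisfies_relations_hahn_V])
qed

lemma module_W: "algebra_module W (\<lambda>x. LL_action m n (hahn_natural x))"
  unfolding LL_action_rep
  by (rule algebra_module_endo[OF algebra_hom_rep subspace_W]) (simp add: rep_intertwine)

text \<open>Closure is inherited from the weight space: \<open>v\<close> equals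
  \<open>to_V (from_V v)\<close>, and \<open>to_V\<close> takes values in the carrier.\<close>

lemma module_V: "algebra_module (coord_space d) (hahn_V_action d a b)"
proof -
  have "endo_apply (presented_lift (hahn_V_gen d a b) x) v \<in> coord_space d" if "v \<in> coord_space d" for x v
    using rep_intertwine[OF from_V_in, of x v] to_from_V[OF that] to_V_in
    by (metis hahn_V_action_def)
  then show ?thesis
    unfolding hahn_V_action_def
    by (rule algebra_module_endo[OF algebra_hom_presented_lift[OF satisfies_relations_hahn_V] subspace_coord_space])
qed

lemma isomorphic_W_V:
  "isomorphic_modules W (\<lambda>x. LL_action m n (hahn_natural x)) (coord_space d) (hahn_V_action d a b)"
  unfolding isomorphic_modules_def
  using module_W module_V bij_to_V
  by (auto simp: LL_action_rep rep_intertwine clinear_add[OF clinear_to_V] clinear_scale[OF clinear_to_V]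
      intro!: exI[of _ to_V])

section \<open>Irreducibility of V_d(a, b)\<close>

lemma irreducible_V: "irreducible_module (coord_space d) (hahn_V_action d a b)"
  unfolding irreducible_module_def
proof (intro conjI allI impI)
  show "algebra_module (coord_space d) (hahn_V_action d a b)" by (rule module_V)
  have "basis_vec 0 \<in> coord_space d"
    unfolding coord_space_def by (intro complex_vector.span_base) auto
  moreover have "basis_vec 0 \<noteq> (0 :: nat \<Rightarrow>\<^sub>0 complex)"
    by (metis lookup_single_eq lookup_zero zero_neq_one)
  ultimately show "coord_space d \<noteq> {0}" by auto
next
  fix U assume sub: "submodule U (coord_space d) (hahn_V_action d a b)"
  let ?A = "endo_apply (hahn_V_A d a b)" and ?B = "endo_apply (hahn_V_B d b)"
  have U: "csubspace U" "U \<subseteq> coord_space d" using sub by (auto simp: submodule_def)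
  have act: "hahn_V_action d a b (gen g) = endo_apply (hahn_V_gen d a b g)" for g
    by (simp add: hahn_V_action_def presented_lift_gen[OF satisfies_relations_hahn_V])
  have AU: "?A x \<in> U" and BU: "?B x \<in> U" if "x \<in> U" for x
    using sub that act[of Agen, symmetric] act[of Bgen, symmetric] by (auto simp: submodule_def)
  have components: "c i *\<^sub>C z i \<in> U"
    if "finite I" "I \<subseteq> {..d}" "(\<Sum>i\<in>I. c i *\<^sub>C z i) \<in> U" "i \<in> I" for I c i
    by (rule eigenvector_components_in_invariant_subspace[OF U(1) clinear_endo_apply AU that(1)
          inj_hahn_theta A_z that(3,4)]) (use that in auto)
  have neighbours: "raise_coeff d e i *\<^sub>C z (i + 1) + lower_coeff h i *\<^sub>C z (i - 1) \<in> U"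
    if "z i \<in> U" for i
  proof -
    have "?B (z i) - (hahn_theta_star b 0 - raise_coeff d e i - lower_coeff h i) *\<^sub>C z i \<in> U"
      using that BU U(1) by (intro complex_vector.subspace_diff complex_vector.subspace_scale)
    then show ?thesis by (simp add: B_z add.assoc)
  qed
  \<comment> \<open>A separates the two neighbours. The bound \<open>i < d\<close> keeps
    \<open>z (i + 1)\<close> among the known eigenvectors; for \<open>i = 0\<close> the truncated
    index carries coefficient zero.\<close>
  have split: "raise_coeff d e i *\<^sub>C z (i + 1) \<in> U \<and> lower_coeff h i *\<^sub>C z (i - 1) \<in> U"
    if "z i \<in> U" "i < d" for i
  proof -
    let ?c = "\<lambda>k. if k = i + 1 then raise_coeff d e i else lower_coeff h i"
    have sum: "(\<Sum>k\<in>{i + 1, i - 1}. ?c k *\<^sub>C z k) \<in> U"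
      using neighbours[OF that(1)] by (cases i) simp_all
    show ?thesis
      using components[OF _ _ sum, of "i + 1"] components[OF _ _ sum, of "i - 1"] that(2)
      by (cases i) simp_all
  qed
  have up: "z (Suc i) \<in> U" if "z i \<in> U" "i < d" for i
    using subspace_scale_cancel[OF U(1) _ raise_coeff_nonzero[OF d_le_e that(2)]] split[OF that] by simp
  have down: "z i \<in> U" if "z (Suc i) \<in> U" "Suc i \<le> d" for i
  proof -
    have "lower_coeff h (Suc i) *\<^sub>C z i \<in> U"
    proof (cases "Suc i = d")
      \<comment> \<open>At the top p_d = 0, so the lower neighbour already stands alone.\<close>
      case True
      then have "raise_coeff d e (Suc i) = 0" by (simp add: raise_coeff_def)
      then show ?thesis using neighbours[OF that(1)] by simp
    next
      case False
      then show ?thesis using split[OF that(1)] that(2) by simp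
    qed
    moreover have "lower_coeff h (Suc i) \<noteq> 0"
      unfolding lower_coeff_def by (metis Suc_neq_Zero add_is_0 mult_eq_0_iff of_nat_0_eq_iff of_nat_add)
    ultimately show ?thesis using subspace_scale_cancel[OF U(1)] by blast
  qed
  show "U = {0} \<or> U = coord_space d"
  proof (cases "U = {0}")
    case False
    then obtain x where x: "x \<in> U" "x \<noteq> 0"
      using complex_vector.subspace_0[OF U(1)] by auto
    \<comment> \<open>The coordinates of \<open>x\<close> in the \<open>z i\<close> are those of
      \<open>from_V x\<close> in the \<open>u i\<close>. A nonzero one puts some \<open>z i\<close>
      into \<open>U\<close>, and \<open>up\<close> and \<open>down\<close> reach the others.\<close>
    define c where "c i = tensor_coord (i0 + i) (j0 - i) (from_V x)" for i
    have sum: "x = (\<Sum>i\<le>d. c i *\<^sub>C z i)"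
      using to_from_V[of x] x(1) U(2) by (auto simp: to_V_def c_def)
    then obtain i where i: "i \<le> d" "c i \<noteq> 0"
      using x(2) by (metis (no_types, lifting) atMost_iff complex_vector.scale_zero_left sum.neutral)
    have "c i *\<^sub>C z i \<in> U"
      using components[of "{..d}" c i] sum x(1) i(1) by simp
    then have zi: "z i \<in> U" using subspace_scale_cancel[OF U(1) _ i(2)] by blast
    have "z j \<in> U" if "j \<le> d" for j
    proof (cases "i \<le> j")
      case True
      then show ?thesis using that
        by (induction rule: dec_induct) (auto simp: zi intro: up)
    next
      case False
      then have "j \<le> i" by simp
      then show ?thesis
        by (induction rule: inc_induct) (use zi i(1) down in auto)
    qed
    then have "split_of_eigen d e z k \<in> U" for k
      unfolding split_of_eigen_def
      by (intro complex_vector.subspace_sum[OF U(1)] complex_vector.subspace_scale[OF U(1)]) simp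
    then have "basis_vec k \<in> U" if "k \<le> d" for k
      using that d_le_e split_of_eigen_of_split[of d e k basis_vec] by (metis z_def)
    then have "coord_space d \<subseteq> U"
      unfolding coord_space_def by (intro complex_vector.span_minimal U(1)) auto
    with U(2) show ?thesis by auto
  qed simp
qed

end

end

section \<open>Matching the parameters\<close>

theorem theorem4p2:
  fixes m n l d :: nat and a b :: complex
  assumes "l \<le> m + n"
    and "a = of_nat (min n l) - of_nat (min m l) + (of_nat m - of_nat n) / 2"
    and "b = - (of_nat m + of_nat n) / 2 - 1"
    and "d = min m l + min n l - l"
  shows "irreducible_module (coord_space d) (hahn_V_action d a b)
    \<and> isomorphic_modules
      (weight_space (LL_space m n) (LL_action m n) (of_nat m + of_nat n - 2 * of_nat l))
      (\<lambda>x. LL_action m n (hahn_natural x))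
      (coord_space d) (hahn_V_action d a b)"
proof -
  \<comment> \<open>The point with the largest second index on the antidiagonal i + j = l of the
    rectangle.\<close>
  define j0 i0 where "j0 = min n l" and "i0 = l - j0"
  \<comment> \<open>\<open>e\<close> is forced by d + e = m - i0 + j0 and min m l = i0 + d; in
    \<open>h\<close> one of the summands \<open>n - j0\<close> and \<open>i0\<close> is
    zero.\<close>
  define e h where "e = j0 + m - min m l" and "h = n - j0 + i0"
  interpret weight_basis m n i0 j0 d e h
    using assms(1) unfolding assms(4) e_def h_def i0_def j0_def
    by unfold_locales (auto simp: min_def)
  have l: "i0 + j0 = l" by (simp add: i0_def j0_def)
  have "min m l = i0 + d"
    using assms(1) by (auto simp: assms(4) i0_def j0_def)
  then have "a = of_nat m / 2 - of_nat n / 2 + of_nat j0 - of_nat i0 - of_nat d"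
    by (simp add: assms(2) j0_def diff_divide_distrib)
  then show ?thesis
    using irreducible_V[OF _ assms(3)] isomorphic_W_V[OF _ assms(3)] unfolding W_def l by blast
qed

end
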